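(* Let $\mathcal{H}=\mathbb{R}^n$ and suppose that the standing assumptions listed in the context hold. Let $\{u_k\},\{z_k\},\{x_k\}$ be generated by the non-stationary Forward--Douglas--Rachford iteration: $z_0\in\mathbb{R}^n$, $x_0=\mathrm{P}_V(z_0)$ and, for $k\ge 0$, $$u_{k+1}=\mathrm{prox}_{\gamma_k R}\big(2x_k-z_k-\gamma_k\nabla G(x_k)\big),\quad z_{k+1}=z_k+\lambda_k(u_{k+1}-x_k),\quad x_{k+1}=\mathrm{P}_V(z_{k+1}),$$ so that $(u_k,x_k,z_k)\to(x^\star,x^\star,z^\star)$, where $z^\star\in\mathrm{fix}(\mathscr{F}_\gamma)$ and $x^\star=\mathrm{P}_V(z^\star)\in\operatorname{Argmin}(\Phi_V)$. Assume moreover that $R$ is partly smooth at $x^\star$ relative to a set $\mathcal{M}^R_{x^\star}$ and that the non-degeneracy condition $$\frac{x^\star-z^\star}{\gamma}-\nabla G(x^\star)\in\mathrm{ri}\big(\partial R(x^\star)\big)$$ holds. Then: (i) There exists $K\in\mathbb{N}$ such that $u_k\in\mathcal{M}^R_{x^\star}$ for all $k\ge K$. (ii) Moreover, (a) if $\mathcal{M}^R_{x^\star}=x^\star+T^R_{x^\star}$, then $T^R_{u_k}=T^R_{x^\star}$ for every $k\ge K$; (b) if $R$ is locally polyhedral around $x^\star$, then, for every $k\ge K$, $u_k\in\mathcal{M}^R_{x^\star}=x^\star+T^R_{x^\star}$, $T^R_{u_k}=T^R_{x^\star}$, $\nabla_{\mathcal{M}^R_{x^\star}}R(u_k)=\nabla_{\mathcal{M}^R_{x^\star}}R(x^\star)$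 and $\nabla^2_{\mathcal{M}^R_{x^\star}}R(u_k)=0$.
   Context: Standing assumptions ($\mathcal{H}=\mathbb{R}^n$). $R:\mathbb{R}^n\to\,]-\infty,+\infty]$ is proper convex lower semicontinuous. $F:\mathbb{R}^n\to\mathbb{R}$ is convex, continuously differentiable, with $\nabla F$ being $(1/\beta)$-Lipschitz, $\beta>0$. $V$ is a vector subspace with orthogonal projector $\mathrm{P}_V$. $G:=F\circ\mathrm{P}_V$, so $\nabla G=\mathrm{P}_V\circ\nabla F\circ\mathrm{P}_V$; $\beta_V\ge\beta$ is a constant such that $\nabla G$ is $(1/\beta_V)$-Lipschitz. $\Phi_V:=G+R+\iota_V$ ($\iota_V$ the indicator function of $V$), and $\operatorname{Argmin}(\Phi_V)\ne\emptyset$. Parameters: $0<\underline{\gamma}\le\gamma_k\le\overline{\gamma}<2\beta_V$, $\gamma_k\to\gamma\in[\underline\gamma,\overline\gamma]$; $\lambda_k\in\,]0,\frac{4\beta_V-\gamma_k}{2\beta_V}[$; $\sum_k\lambda_k\big(\frac{4\beta_V-\gamma_k}{2\beta_V}-\lambda_k\big)=+\infty$; $\sum_k\lambda_k|\gamma_k-\gamma|<+\infty$. Notation: $\mathrm{prox}_{\gamma R}(x)=\operatorname{argmin}_u\gamma R(u)+\frac12\|u-x\|^2$; $\mathcal{R}_{\gamma R}=2\,\mathrm{prox}_{\gamma R}-\mathrm{Id}$; $\mathcal{R}_V=2\mathrm{P}_V-\mathrm{Id}$; $\mathscr{F}_\gamma=\frac12(\mathrm{Id}+\mathcal{R}_{\gamma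 R}\circ\mathcal{R}_V)\circ(\mathrm{Id}-\gamma\nabla G)$, with fixed point set $\mathrm{fix}(\mathscr{F}_\gamma)$; $\mathrm{ri}$ is the relative interior. For a nonempty convex set $C$, $\mathrm{par}(C)$ is the linear subspace parallel to its affine hull, and $T^R_x:=\mathrm{par}(\partial R(x))^\perp$. Partial smoothness: $R$ is partly smooth at $x$ (with $\partial R(x)\ne\emptyset$) relative to a set $\mathcal{M}\ni x$ if (1) $\mathcal{M}$ is a $C^2$-smooth embedded submanifold of $\mathbb{R}^n$ around $x$ and $R|_{\mathcal{M}}$ is $C^2$ around $x$; (2) the tangent space of $\mathcal{M}$ at $x$ equals $T^R_x$; (3) the set-valued map $\partial R$ is continuous at $x$ relative to $\mathcal{M}$. Riemannian derivatives: for a function $J$ that is $C^2$ on $\mathcal{M}$ near $x$, with tangent space $\mathcal{T}_{\mathcal{M}}(x)$ and projection $\mathrm{P}_{\mathcal{M}}$ onto $\mathcal{M}$, $\nabla_{\mathcal{M}}J(x)\in\mathcal{T}_{\mathcal{M}}(x)$ is defined by $\langle\nabla_{\mathcal{M}}J(x),h\rangle=\frac{d}{dt}J(\mathrm{P}_{\mathcal{M}}(x+th))|_{t=0}$ and $\nabla^2_{\mathcal{M}}J(x)$ is the symmetric linear map of $\mathcal{T}_{\mathcal{M}}(x)$ with $\langle\nabla^2_{\mathcal{M}}J(x)h,h\rangle=\frac{d^2}{dt^2}J(\mathrm{P}_{\mathcal{M}}(x+th))|_{t=0}$, for all $h\in\mathcal{T}_{\mathcal{M}}(x)$. "Locally polyhedral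 around $x^\star$" means that $R$ coincides with a polyhedral convex function in a neighbourhood of $x^\star$.
   Formalization: In (ii)(b) the equality of the manifold with x*+T is proved only in a neighbourhood of x* (globally it fails: R=0 on the line, manifold ]-1,1[, x*=0), with u_k in x*+T stated separately; in (ii)(a) the equality is likewise assumed only near x*. *)

theory Defs
  imports "HOL-Analysis.Analysis"
begin

section \<open>Extended-real-valued convex functions\<close>

text \<open>
  Functions with values in ]-\<infinity>, +\<infinity>] are functions into \<open>ereal\<close> that never take the value
  \<open>-\<infinity>\<close>; this is part of \<open>proper_fun\<close>.  In \<open>ereal\<close> we have \<open>0 * \<infinity> = 0\<close>, so the cases
  \<open>t = 0\<close> and \<open>t = 1\<close> of \<open>convex_fun\<close> are trivial.
\<close>

definition proper_fun :: "('a \<Rightarrow> ereal) \<Rightarrow> bool" where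
  "proper_fun R \<longleftrightarrow> (\<forall>x. R x \<noteq> -\<infinity>) \<and> (\<exists>x. R x \<noteq> \<infinity>)"

definition convex_fun :: "('a::real_vector \<Rightarrow> ereal) \<Rightarrow> bool" where
  "convex_fun R \<longleftrightarrow>
     (\<forall>x y. \<forall>t\<in>{0..1}. R ((1 - t) *\<^sub>R x + t *\<^sub>R y) \<le> ereal (1 - t) * R x + ereal t * R y)"

definition lsc_fun :: "('a::topological_space \<Rightarrow> ereal) \<Rightarrow> bool" where
  "lsc_fun R \<longleftrightarrow> (\<forall>x. R x \<le> Liminf (at x) R)"

definition subdifferential :: "('a::real_inner \<Rightarrow> ereal) \<Rightarrow> 'a \<Rightarrow> 'a set" where
  "subdifferential R x = {g. \<forall>y. R x + ereal (g \<bullet> (y - x)) \<le> R y}"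

definition Argmin :: "('a \<Rightarrow> ereal) \<Rightarrow> 'a set" where
  "Argmin f = {x. is_arg_min f (\<lambda>_. True) x}"

definition indicator_fun :: "'a set \<Rightarrow> 'a \<Rightarrow> ereal" where
  "indicator_fun V x = (if x \<in> V then 0 else \<infinity>)"

text \<open>For \<open>\<gamma> > 0\<close> and \<open>R\<close> proper, convex and lower semicontinuous the minimiser is unique.\<close>

definition prox :: "real \<Rightarrow> ('a::real_normed_vector \<Rightarrow> ereal) \<Rightarrow> 'a \<Rightarrow> 'a" where
  "prox \<gamma> R x = arg_min (\<lambda>u. ereal \<gamma> * R u + ereal (1/2 * (norm (u - x))\<^sup>2)) (\<lambda>_. True)"

text \<open>
  A convex function is polyhedral iff its epigraph is a polyhedron; the value \<open>\<infinity>\<close> is allowed.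
\<close>

definition polyhedral_fun :: "('a::euclidean_space \<Rightarrow> ereal) \<Rightarrow> bool" where
  "polyhedral_fun P \<longleftrightarrow> polyhedron {(y, r). P y \<le> ereal r}"

definition locally_polyhedral_around :: "('a::euclidean_space \<Rightarrow> ereal) \<Rightarrow> 'a \<Rightarrow> bool" where
  "locally_polyhedral_around R x \<longleftrightarrow>
     (\<exists>P. polyhedral_fun P \<and> (\<forall>\<^sub>F y in nhds x. R y = P y))"

section \<open>The fixed-point operator\<close>

text \<open>
  The orthogonal projector onto a subspace \<open>V\<close> is the nearest-point map \<open>closest_point V\<close>.
\<close>

definition reflected_prox :: "real \<Rightarrow> ('a::real_normed_vector \<Rightarrow> ereal) \<Rightarrow> 'a \<Rightarrow> 'a" where
  "reflected_prox \<gamma> R x = 2 *\<^sub>R prox \<gamma> R x - x"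

definition reflection :: "'a::euclidean_space set \<Rightarrow> 'a \<Rightarrow> 'a" where
  "reflection V x = 2 *\<^sub>R closest_point V x - x"

definition fdr_operator ::
  "real \<Rightarrow> ('a::euclidean_space \<Rightarrow> ereal) \<Rightarrow> 'a set \<Rightarrow> ('a \<Rightarrow> 'a) \<Rightarrow> 'a \<Rightarrow> 'a" where
  "fdr_operator \<gamma> R V gradG =
     (\<lambda>w. (1/2) *\<^sub>R (w + reflected_prox \<gamma> R (reflection V w))) \<circ> (\<lambda>z. z - \<gamma> *\<^sub>R gradG z)"

definition fix_set :: "('a \<Rightarrow> 'a) \<Rightarrow> 'a set" where
  "fix_set f = {z. f z = z}"

section \<open>Partial smoothness\<close>

definition par :: "'a::real_vector set \<Rightarrow> 'a set" where
  "par C = {a - b |a b. a \<in> affine hull C \<and> b \<in> affine hull C}"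

definition model_subspace :: "('a::euclidean_space \<Rightarrow> ereal) \<Rightarrow> 'a \<Rightarrow> 'a set" where
  "model_subspace R x = orthogonal_comp (par (subdifferential R x))"

text \<open>\<open>C2_on U f\<close> is meant for open \<open>U\<close>: \<open>f\<close> is twice continuously differentiable on \<open>U\<close>.\<close>

definition C2_on :: "'a::real_normed_vector set \<Rightarrow> ('a \<Rightarrow> 'b::real_normed_vector) \<Rightarrow> bool" where
  "C2_on U f \<longleftrightarrow>
     (\<exists>(f' :: 'a \<Rightarrow> 'a \<Rightarrow>\<^sub>L 'b) (f'' :: 'a \<Rightarrow> 'a \<Rightarrow>\<^sub>L 'a \<Rightarrow>\<^sub>L 'b).
        (\<forall>x\<in>U. (f has_derivative blinfun_apply (f' x)) (at x)) \<and>
        (\<forall>x\<in>U. (f' has_derivative blinfun_apply (f'' x)) (at x)) \<and>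
        continuous_on U f'')"

text \<open>
  An embedded submanifold around \<open>x\<close>, by a slice chart: a \<open>C\<^sup>2\<close> diffeomorphism \<open>\<phi>\<close> from a
  neighbourhood of \<open>x\<close> onto an open set carries \<open>M\<close> locally to a linear subspace.  Nothing is
  required of \<open>M\<close> away from \<open>x\<close>.
\<close>

definition C2_submanifold_around :: "'a::euclidean_space set \<Rightarrow> 'a \<Rightarrow> bool" where
  "C2_submanifold_around M x \<longleftrightarrow> x \<in> M \<and>
     (\<exists>U W \<phi> (\<psi> :: 'a \<Rightarrow> 'a) S. open U \<and> x \<in> U \<and> open W \<and> subspace S \<and>
        homeomorphism U W \<phi> \<psi> \<and> C2_on U \<phi> \<and> C2_on W \<psi> \<and> \<phi> ` (M \<inter> U) = S \<inter> W)"

text \<open>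
  \<open>J\<close> restricted to \<open>M\<close> is finite and \<open>C\<^sup>2\<close> around \<open>x\<close>: it has a local \<open>C\<^sup>2\<close> extension to
  the ambient space.
\<close>

definition C2_along_around :: "('a::euclidean_space \<Rightarrow> ereal) \<Rightarrow> 'a set \<Rightarrow> 'a \<Rightarrow> bool" where
  "C2_along_around J M x \<longleftrightarrow>
     (\<exists>U g. open U \<and> x \<in> U \<and> C2_on U g \<and> (\<forall>y\<in>M \<inter> U. J y = ereal (g y)))"

definition tangent_space :: "'a::euclidean_space set \<Rightarrow> 'a \<Rightarrow> 'a set" where
  "tangent_space M x =
     {v. \<exists>c e. e > 0 \<and> c C1_differentiable_on {-e<..<e} \<and> c ` {-e<..<e} \<subseteq> M \<and>
               c 0 = x \<and> (c has_vector_derivative v) (at 0)}"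

text \<open>
  Outer and inner limits (Painleve--Kuratowski) of a set-valued map at \<open>x\<close> relative to \<open>M\<close>.
\<close>

definition outer_limit :: "('a::metric_space \<Rightarrow> 'b::metric_space set) \<Rightarrow> 'a set \<Rightarrow> 'a \<Rightarrow> 'b set" where
  "outer_limit S M x =
     {g. \<exists>y h. (\<forall>n::nat. y n \<in> M \<and> h n \<in> S (y n)) \<and> y \<longlonglongrightarrow> x \<and> h \<longlonglongrightarrow> g}"

definition inner_limit :: "('a::metric_space \<Rightarrow> 'b::metric_space set) \<Rightarrow> 'a set \<Rightarrow> 'a \<Rightarrow> 'b set" where
  "inner_limit S M x =
     {g. \<forall>y. (\<forall>n::nat. y n \<in> M) \<and> y \<longlonglongrightarrow> x \<longrightarrow>
             (\<exists>h. (\<forall>\<^sub>F n in sequentially. h n \<in> S (y n)) \<and> h \<longlonglongrightarrow> g)}"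

definition setvalued_continuous_at ::
  "('a::metric_space \<Rightarrow> 'b::metric_space set) \<Rightarrow> 'a set \<Rightarrow> 'a \<Rightarrow> bool" where
  "setvalued_continuous_at S M x \<longleftrightarrow> outer_limit S M x \<subseteq> S x \<and> S x \<subseteq> inner_limit S M x"

definition partly_smooth_at :: "('a::euclidean_space \<Rightarrow> ereal) \<Rightarrow> 'a \<Rightarrow> 'a set \<Rightarrow> bool" where
  "partly_smooth_at R x M \<longleftrightarrow>
     x \<in> M \<and> subdifferential R x \<noteq> {} \<and>
     C2_submanifold_around M x \<and> C2_along_around R M x \<and>
     tangent_space M x = model_subspace R x \<and>
     setvalued_continuous_at (subdifferential R) M x"

text \<open>
  A partly smooth manifold is determined only as a germ: replacing \<open>M\<close> by its intersection with
  a neighbourhood of \<open>x\<close> does not affect \<open>partly_smooth_at R x M\<close>.  Equality of \<open>M\<close> with an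
  affine subspace is accordingly understood as equality near the base point.
\<close>

definition coincide_around :: "'a::topological_space \<Rightarrow> 'a set \<Rightarrow> 'a set \<Rightarrow> bool" where
  "coincide_around x A B \<longleftrightarrow> (\<exists>U. open U \<and> x \<in> U \<and> A \<inter> U = B \<inter> U)"

section \<open>Riemannian gradient and Hessian\<close>

text \<open>
  Both are relations, as with \<open>has_derivative\<close>, so that asserting one includes existence.
  \<open>closest_point M\<close> is the projection onto \<open>M\<close>, which is uniquely defined near a point around
  which \<open>M\<close> is a \<open>C\<^sup>2\<close> submanifold.  The Hessian is an endomorphism of the tangent space;
  values of \<open>H\<close> outside it are irrelevant.
\<close>

definition has_riemannian_gradient ::
  "('a::euclidean_space \<Rightarrow> ereal) \<Rightarrow> 'a set \<Rightarrow> 'a \<Rightarrow> 'a \<Rightarrow> bool" where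
  "has_riemannian_gradient J M x v \<longleftrightarrow>
     C2_submanifold_around M x \<and> C2_along_around J M x \<and>
     v \<in> tangent_space M x \<and>
     (\<forall>h\<in>tangent_space M x.
        ((\<lambda>t. real_of_ereal (J (closest_point M (x + t *\<^sub>R h)))) has_real_derivative (v \<bullet> h)) (at 0))"

definition has_second_derivative_at :: "(real \<Rightarrow> real) \<Rightarrow> real \<Rightarrow> real \<Rightarrow> bool" where
  "has_second_derivative_at f d t \<longleftrightarrow>
     (\<exists>f'. (\<forall>\<^sub>F s in nhds t. (f has_real_derivative f' s) (at s)) \<and>
           (f' has_real_derivative d) (at t))"

definition has_riemannian_hessian ::
  "('a::euclidean_space \<Rightarrow> ereal) \<Rightarrow> 'a set \<Rightarrow> 'a \<Rightarrow> ('a \<Rightarrow> 'a) \<Rightarrow> bool" where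
  "has_riemannian_hessian J M x H \<longleftrightarrow>
     C2_submanifold_around M x \<and> C2_along_around J M x \<and>
     H ` tangent_space M x \<subseteq> tangent_space M x \<and>
     (\<forall>h\<in>tangent_space M x. \<forall>k\<in>tangent_space M x. \<forall>a b.
        H (a *\<^sub>R h + b *\<^sub>R k) = a *\<^sub>R H h + b *\<^sub>R H k) \<and>
     (\<forall>h\<in>tangent_space M x. \<forall>k\<in>tangent_space M x. H h \<bullet> k = h \<bullet> H k) \<and>
     (\<forall>h\<in>tangent_space M x.
        has_second_derivative_at
          (\<lambda>t. real_of_ereal (J (closest_point M (x + t *\<^sub>R h)))) (H h \<bullet> h) 0)"

end

theory Submission
  imports Defs
begin

text \<open>
  The optimality condition of the proximal step exhibits subgradients of \<open>R\<close> at \<open>u k\<close> that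
  converge to the non-degenerate subgradient \<open>g\<close> at \<open>xs\<close>.  If \<open>u k\<close> stayed off \<open>M\<close>, its normalised
  displacements from points of \<open>M\<close> would have a limit \<open>n\<close> outside the tangent space; pushing \<open>g\<close>
  inside the subdifferential in a direction correlated with \<open>n\<close> and moving the result along \<open>M\<close>
  by inner continuity violates monotonicity of the subdifferential.

  In the affine case, \<open>C\<^sup>2\<close> smoothness along \<open>M\<close> forces all subgradients at a nearby point of \<open>M\<close>
  to agree on the tangent space, while inner continuity keeps the span of their differences from
  shrinking.

  In the polyhedral case, subgradients at nearby points that are close to \<open>g\<close> are subgradients at
  \<open>xs\<close>, whence \<open>M\<close> lies in the affine tangent space and \<open>R\<close> is affine on it; invariance of domain
  shows that \<open>M\<close> fills this space locally.
\<close>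

section \<open>Subgradients and the proximal map\<close>

lemma subgradient_finite:
  assumes "proper_fun R" "g \<in> subdifferential R x"
  shows "\<bar>R x\<bar> \<noteq> \<infinity>"
proof -
  obtain y where y: "R y \<noteq> \<infinity>" using assms(1) by (auto simp: proper_fun_def)
  have "R x + ereal (g \<bullet> (y - x)) \<le> R y" using assms(2) by (auto simp: subdifferential_def)
  with y have "R x \<noteq> \<infinity>" by auto
  moreover have "R x \<noteq> -\<infinity>" using assms(1) by (auto simp: proper_fun_def)
  ultimately show ?thesis by auto
qed

lemma subgradient_ineq:
  assumes "g \<in> subdifferential R x" "R x = ereal r" "R y = ereal s"
  shows "r + g \<bullet> (y - x) \<le> s"
proof -
  have "R x + ereal (g \<bullet> (y - x)) \<le> R y" using assms(1) by (auto simp: subdifferential_def)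
  then show ?thesis using assms by simp
qed

lemma subdifferential_monotone:
  assumes "proper_fun R" "g \<in> subdifferential R x" "h \<in> subdifferential R y"
  shows "0 \<le> (g - h) \<bullet> (x - y)"
proof -
  obtain r where r: "R x = ereal r" using subgradient_finite[OF assms(1,2)] by auto
  obtain s where s: "R y = ereal s" using subgradient_finite[OF assms(1,3)] by auto
  note subgradient_ineq[OF assms(2) r s] subgradient_ineq[OF assms(3) s r]
  then show ?thesis by (simp add: inner_diff_left inner_diff_right)
qed

lemma lsc_fun_sequential:
  assumes "lsc_fun f" and a: "a \<longlonglongrightarrow> x" and fa: "(\<lambda>n. f (a n)) \<longlonglongrightarrow> m"
  shows "f x \<le> m"
proof (rule ccontr)
  assume "\<not> f x \<le> m"
  then obtain c where c: "m < c" "c < f x" using dense[of m "f x"] by (auto simp: not_le)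
  then have "c < Liminf (at x) f" using assms(1) unfolding lsc_fun_def by (meson less_le_trans)
  then have "\<forall>\<^sub>F y in at x. c < f y" by (rule less_LiminfD)
  then have "\<forall>\<^sub>F y in nhds x. c < f y" using c by (simp add: eventually_nhds_conv_at)
  then have "\<forall>\<^sub>F n in sequentially. c < f (a n)" using a by (rule eventually_compose_filterlim)
  then have "c \<le> m" by (intro tendsto_lowerbound[OF fa]) (auto elim: eventually_mono)
  with c show False by simp
qed

text \<open>
  The subgradient supplies the affine minorant that makes the proximal objective coercive.
\<close>
lemma prox_objective_minimizer:
  fixes R :: "'a::euclidean_space \<Rightarrow> ereal"
  assumes proper: "proper_fun R" and lsc: "lsc_fun R" and \<gamma>: "\<gamma> > 0"
    and g: "g \<in> subdifferential R x0"
  obtains p \<rho> where "R p = ereal \<rho>"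
    "\<And>y s. R y = ereal s \<Longrightarrow> \<gamma> * \<rho> + 1/2 * (norm (p - x))\<^sup>2 \<le> \<gamma> * s + 1/2 * (norm (y - x))\<^sup>2"
proof -
  obtain r0 where r0: "R x0 = ereal r0" using subgradient_finite[OF proper g] by auto
  define C where "C = \<gamma> * r0 + \<gamma> * (g \<bullet> (x - x0)) - \<gamma>\<^sup>2 * (norm g)\<^sup>2"
  have low: "C + 1/4 * (norm (y - x))\<^sup>2 \<le> \<gamma> * s + 1/2 * (norm (y - x))\<^sup>2" if "R y = ereal s" for y s
  proof -
    have "0 \<le> (norm (\<gamma> *\<^sub>R g + (1/2) *\<^sub>R (y - x)))\<^sup>2" by simp
    also have "\<dots> = \<gamma>\<^sup>2 * (norm g)\<^sup>2 + \<gamma> * (g \<bullet> (y - x)) + 1/4 * (norm (y - x))\<^sup>2"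
      unfolding power2_norm_eq_inner
      by (simp add: inner_add_left inner_add_right inner_commute power2_eq_square algebra_simps)
    finally have 1: "0 \<le> \<gamma>\<^sup>2 * (norm g)\<^sup>2 + \<gamma> * (g \<bullet> (y - x)) + 1/4 * (norm (y - x))\<^sup>2" .
    have "\<gamma> * (r0 + g \<bullet> (y - x0)) \<le> \<gamma> * s"
      using subgradient_ineq[OF g r0 that] \<gamma> by simp
    moreover have "\<gamma> * (r0 + g \<bullet> (y - x0)) = \<gamma> * r0 + \<gamma> * (g \<bullet> (x - x0)) + \<gamma> * (g \<bullet> (y - x))"
      by (simp add: inner_diff_right algebra_simps)
    ultimately show ?thesis using 1 unfolding C_def by linarith
  qed
  define A where "A = {\<gamma> * s + 1/2 * (norm (y - x))\<^sup>2 |y s. R y = ereal s}"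
  have ne: "A \<noteq> {}" using r0 by (auto simp: A_def)
  have "C \<le> a" if a: "a \<in> A" for a
  proof -
    obtain y s where "a = \<gamma> * s + 1/2 * (norm (y - x))\<^sup>2" "R y = ereal s" using a unfolding A_def by blast
    with low[of y s] show ?thesis using zero_le_power2[of "norm (y - x)"] by linarith
  qed
  then have bdd: "bdd_below A" by (auto simp: bdd_below_def)
  define m where "m = Inf A"
  have "\<exists>a\<in>A. a < m + 1 / real (Suc n)" for n
    using cInf_lessD[OF ne, of "m + 1 / real (Suc n)"] by (auto simp: m_def)
  then have "\<forall>n. \<exists>y s. R y = ereal s \<and> \<gamma> * s + 1/2 * (norm (y - x))\<^sup>2 < m + 1 / real (Suc n)"
    unfolding A_def by blast
  then obtain y s where ys: "\<And>n. R (y n) = ereal (s n)"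
    "\<And>n. \<gamma> * s n + 1/2 * (norm (y n - x))\<^sup>2 < m + 1 / real (Suc n)" by metis
  have mle: "m \<le> \<gamma> * t + 1/2 * (norm (w - x))\<^sup>2" if "R w = ereal t" for w t
    unfolding m_def by (rule cInf_lower[OF _ bdd]) (use that in \<open>auto simp: A_def\<close>)
  have lim: "(\<lambda>n. \<gamma> * s n + 1/2 * (norm (y n - x))\<^sup>2) \<longlonglongrightarrow> m"
  proof (rule tendsto_sandwich)
    show "(\<lambda>n. m) \<longlonglongrightarrow> m" by simp
    show "(\<lambda>n. m + 1 / real (Suc n)) \<longlonglongrightarrow> m"
      using tendsto_add[OF tendsto_const LIMSEQ_inverse_real_of_nat, of m] by (simp add: inverse_eq_divide)
  qed (use mle ys in \<open>simp_all add: less_imp_le\<close>)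
  have "norm (y n - x) \<le> 4 * (m + 1 - C) + 1" for n
  proof -
    have "1 / real (Suc n) \<le> 1" by simp
    then have "\<gamma> * s n + 1/2 * (norm (y n - x))\<^sup>2 < m + 1" using ys(2)[of n] by (meson add_left_mono less_le_trans)
    then have 1: "(norm (y n - x))\<^sup>2 \<le> 4 * (m + 1 - C)" using low[OF ys(1)[of n]] by argo
    have "0 \<le> (norm (y n - x) - 1)\<^sup>2" by simp
    then have "2 * norm (y n - x) \<le> (norm (y n - x))\<^sup>2 + 1" by (simp add: power2_diff)
    with 1 show ?thesis using zero_le_power2[of "norm (y n - x)"] by linarith
  qed
  then have "range y \<subseteq> cball x (4 * (m + 1 - C) + 1)" by (auto simp: dist_norm norm_minus_commute)
  then have "bounded (range y)" using bounded_cball bounded_subset by blast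
  then obtain p r where r: "strict_mono (r :: nat \<Rightarrow> nat)" "(y \<circ> r) \<longlonglongrightarrow> p"
    using bounded_imp_convergent_subsequence by blast
  define \<rho>' where "\<rho>' = (m - 1/2 * (norm (p - x))\<^sup>2) / \<gamma>"
  have yr: "(\<lambda>n. y (r n)) \<longlonglongrightarrow> p" using r(2) by (simp add: o_def)
  have "(\<lambda>n. ((\<gamma> * s (r n) + 1/2 * (norm (y (r n) - x))\<^sup>2) - 1/2 * (norm (y (r n) - x))\<^sup>2) / \<gamma>) \<longlonglongrightarrow> \<rho>'"
    unfolding \<rho>'_def
    by (intro tendsto_intros yr LIMSEQ_subseq_LIMSEQ[OF lim r(1), unfolded o_def]) (use \<gamma> in auto)
  then have "(\<lambda>n. s (r n)) \<longlonglongrightarrow> \<rho>'" using \<gamma> by simp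
  then have "(\<lambda>n. R (y (r n))) \<longlonglongrightarrow> ereal \<rho>'" using ys(1) by simp
  then have le: "R p \<le> ereal \<rho>'" by (rule lsc_fun_sequential[OF lsc yr])
  moreover have "R p \<noteq> -\<infinity>" using proper by (auto simp: proper_fun_def)
  ultimately obtain \<rho> where \<rho>: "R p = ereal \<rho>" by (cases "R p") auto
  show ?thesis
  proof
    show "R p = ereal \<rho>" by fact
    fix w t assume w: "R w = ereal t"
    have "\<rho> \<le> \<rho>'" using le \<rho> by simp
    then have "\<gamma> * \<rho> \<le> \<gamma> * \<rho>'" using \<gamma> by simp
    also have "\<gamma> * \<rho>' = m - 1/2 * (norm (p - x))\<^sup>2" using \<gamma> by (simp add: \<rho>'_def)
    finally show "\<gamma> * \<rho> + 1/2 * (norm (p - x))\<^sup>2 \<le> \<gamma> * t + 1/2 * (norm (w - x))\<^sup>2"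
      using mle[OF w] by linarith
  qed
qed

lemma prox_is_minimizer:
  fixes R :: "'a::euclidean_space \<Rightarrow> ereal"
  assumes proper: "proper_fun R" and lsc: "lsc_fun R" and \<gamma>: "\<gamma> > 0"
    and g: "g \<in> subdifferential R x0"
  obtains \<rho> where "R (prox \<gamma> R x) = ereal \<rho>"
    "\<And>y s. R y = ereal s \<Longrightarrow>
       \<gamma> * \<rho> + 1/2 * (norm (prox \<gamma> R x - x))\<^sup>2 \<le> \<gamma> * s + 1/2 * (norm (y - x))\<^sup>2"
proof -
  define f where "f = (\<lambda>u. ereal \<gamma> * R u + ereal (1/2 * (norm (u - x))\<^sup>2))"
  obtain p \<rho> where p: "R p = ereal \<rho>"
    "\<And>y s. R y = ereal s \<Longrightarrow> \<gamma> * \<rho> + 1/2 * (norm (p - x))\<^sup>2 \<le> \<gamma> * s + 1/2 * (norm (y - x))\<^sup>2"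
    using prox_objective_minimizer[OF proper lsc \<gamma> g] by metis
  have fr: "f y = ereal (\<gamma> * s + 1/2 * (norm (y - x))\<^sup>2)" if "R y = ereal s" for y s
    by (simp add: f_def that)
  have finf: "f y = \<infinity>" if "\<And>s. R y \<noteq> ereal s" for y
    using that proper \<gamma> by (cases "R y") (auto simp: f_def proper_fun_def)
  have "f p \<le> f y" for y
    using p finf[of y] fr by (cases "\<exists>s. R y = ereal s") auto
  then have "is_arg_min f (\<lambda>_. True) p" by (auto simp: is_arg_min_def not_less)
  then have "is_arg_min f (\<lambda>_. True) (prox \<gamma> R x)"
    unfolding prox_def f_def[symmetric] arg_min_def by (rule someI)
  then have min: "f (prox \<gamma> R x) \<le> f y" for y by (auto simp: is_arg_min_def not_less)
  have "f (prox \<gamma> R x) \<noteq> \<infinity>" using min[of p] fr[OF p(1)] by auto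
  then obtain \<sigma> where \<sigma>: "R (prox \<gamma> R x) = ereal \<sigma>" using finf by metis
  show ?thesis
  proof
    show "R (prox \<gamma> R x) = ereal \<sigma>" by fact
    fix y s assume "R y = ereal s"
    then show "\<gamma> * \<sigma> + 1/2 * (norm (prox \<gamma> R x - x))\<^sup>2 \<le> \<gamma> * s + 1/2 * (norm (y - x))\<^sup>2"
      using min[of y] fr[OF \<sigma>] fr[of y s] by simp
  qed
qed

lemma prox_subgradient:
  fixes R :: "'a::euclidean_space \<Rightarrow> ereal"
  assumes proper: "proper_fun R" and conv: "convex_fun R" and lsc: "lsc_fun R" and \<gamma>: "\<gamma> > 0"
    and ne: "subdifferential R x0 \<noteq> {}"
  shows "(1 / \<gamma>) *\<^sub>R (x - prox \<gamma> R x) \<in> subdifferential R (prox \<gamma> R x)"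
proof -
  obtain g where g: "g \<in> subdifferential R x0" using ne by auto
  define p where "p = prox \<gamma> R x"
  obtain \<rho> where \<rho>: "R p = ereal \<rho>"
    and min: "\<And>y s. R y = ereal s \<Longrightarrow> \<gamma> * \<rho> + 1/2 * (norm (p - x))\<^sup>2 \<le> \<gamma> * s + 1/2 * (norm (y - x))\<^sup>2"
    unfolding p_def by (rule prox_is_minimizer[OF proper lsc \<gamma> g, where x=x]) blast
  have "R p + ereal (((1 / \<gamma>) *\<^sub>R (x - p)) \<bullet> (y - p)) \<le> R y" for y
  proof (cases "R y")
    case (real s)
    define d where "d = y - p"
    have key: "0 \<le> \<gamma> * (s - \<rho>) + (p - x) \<bullet> d + t / 2 * (norm d)\<^sup>2" if t: "0 < t" "t < 1" for t
    proof -
      have pt: "(1 - t) *\<^sub>R p + t *\<^sub>R y = p + t *\<^sub>R d" by (simp add: d_def algebra_simps)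
      have "R (p + t *\<^sub>R d) \<le> ereal (1 - t) * R p + ereal t * R y"
        using conv t pt unfolding convex_fun_def by (metis atLeastAtMost_iff less_imp_le)
      also have "\<dots> = ereal ((1 - t) * \<rho> + t * s)" using \<rho> real by simp
      finally have le: "R (p + t *\<^sub>R d) \<le> ereal ((1 - t) * \<rho> + t * s)" .
      moreover have "R (p + t *\<^sub>R d) \<noteq> -\<infinity>" using proper by (auto simp: proper_fun_def)
      ultimately obtain \<sigma> where \<sigma>: "R (p + t *\<^sub>R d) = ereal \<sigma>" by (cases "R (p + t *\<^sub>R d)") auto
      have "\<sigma> \<le> (1 - t) * \<rho> + t * s" using le \<sigma> by simp
      then have "\<gamma> * \<sigma> \<le> \<gamma> * ((1 - t) * \<rho> + t * s)" using \<gamma> by simp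
      moreover have "\<gamma> * \<rho> + 1/2 * (norm (p - x))\<^sup>2 \<le> \<gamma> * \<sigma> + 1/2 * (norm (p + t *\<^sub>R d - x))\<^sup>2"
        by (rule min[OF \<sigma>])
      moreover have "(norm (p + t *\<^sub>R d - x))\<^sup>2 = (norm (p - x))\<^sup>2 + 2 * t * ((p - x) \<bullet> d) + t\<^sup>2 * (norm d)\<^sup>2"
        unfolding power2_norm_eq_inner
        by (simp add: inner_add_left inner_add_right inner_diff_left inner_diff_right inner_commute
            power2_eq_square algebra_simps)
      ultimately have "0 \<le> t * (\<gamma> * (s - \<rho>) + (p - x) \<bullet> d + t / 2 * (norm d)\<^sup>2)"
        by (simp add: algebra_simps power2_eq_square)
      then show ?thesis using t by (simp add: zero_le_mult_iff)
    qed
    have "((\<lambda>t. \<gamma> * (s - \<rho>) + (p - x) \<bullet> d + t / 2 * (norm d)\<^sup>2) \<longlongrightarrow>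
        \<gamma> * (s - \<rho>) + (p - x) \<bullet> d + 0 / 2 * (norm d)\<^sup>2) (at_right (0::real))"
      by (intro tendsto_intros) auto
    moreover have "\<forall>\<^sub>F t in at_right (0::real). 0 \<le> \<gamma> * (s - \<rho>) + (p - x) \<bullet> d + t / 2 * (norm d)\<^sup>2"
      unfolding eventually_at_right_field using key by (intro exI[of _ 1]) auto
    ultimately have "0 \<le> \<gamma> * (s - \<rho>) + (p - x) \<bullet> d + 0 / 2 * (norm d)\<^sup>2"
      by (rule tendsto_lowerbound) simp
    then have "(x - p) \<bullet> d \<le> \<gamma> * (s - \<rho>)" by (simp add: inner_diff_left)
    then have "(x - p) \<bullet> d / \<gamma> \<le> s - \<rho>" using \<gamma> by (simp add: pos_divide_le_eq mult.commute)
    then show ?thesis using \<rho> real by (simp add: d_def)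
  qed (use proper in \<open>auto simp: proper_fun_def\<close>)
  then show ?thesis by (simp add: subdifferential_def p_def)
qed

section \<open>Partial smoothness in charts\<close>

lemma not_eventually_nhds_sequence:
  fixes x :: "'a::metric_space"
  assumes "\<not> eventually P (nhds x)"
  obtains f :: "nat \<Rightarrow> 'a" where "f \<longlonglongrightarrow> x" "\<And>n. \<not> P (f n)"
proof -
  have "\<forall>n. \<exists>y. dist y x < 1 / real (Suc n) \<and> \<not> P y"
    using assms unfolding eventually_nhds_metric by (metis of_nat_0_less_iff zero_less_Suc zero_less_divide_1_iff)
  then obtain f where f: "\<And>n. dist (f n) x < 1 / real (Suc n)" "\<And>n. \<not> P (f n)" by metis
  have "(\<lambda>n. dist (f n) x) \<longlonglongrightarrow> 0"
  proof (rule tendsto_sandwich[OF _ _ tendsto_const])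
    show "(\<lambda>n. 1 / real (Suc n)) \<longlonglongrightarrow> 0"
      using LIMSEQ_inverse_real_of_nat by (simp add: inverse_eq_divide)
  qed (use f in \<open>simp_all add: less_imp_le\<close>)
  then have "f \<longlonglongrightarrow> x" using tendsto_dist_iff by blast
  then show ?thesis using f that by blast
qed

lemma setvalued_inner_continuity:
  assumes "setvalued_continuous_at S M x" "g \<in> S x" "e > 0"
  shows "\<forall>\<^sub>F y in nhds x. y \<in> M \<longrightarrow> (\<exists>h\<in>S y. dist h g < e)"
proof (rule ccontr)
  assume "\<not> ?thesis"
  then obtain f where f: "f \<longlonglongrightarrow> x" "\<And>n. f n \<in> M \<and> (\<forall>h\<in>S (f n). \<not> dist h g < e)"
    by (rule not_eventually_nhds_sequence) blast
  have "g \<in> inner_limit S M x" using assms by (auto simp: setvalued_continuous_at_def)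
  then have "\<exists>h. (\<forall>\<^sub>F n in sequentially. h n \<in> S (f n)) \<and> h \<longlonglongrightarrow> g"
    using f by (simp add: inner_limit_def)
  then obtain h where h: "\<forall>\<^sub>F n in sequentially. h n \<in> S (f n)" "h \<longlonglongrightarrow> g"
    by blast
  have "\<forall>\<^sub>F n in sequentially. dist (h n) g < e" using h(2) \<open>e > 0\<close> by (rule tendstoD)
  with h(1) have "\<forall>\<^sub>F n in sequentially. False"
    by eventually_elim (use f in blast)
  then show False by simp
qed

lemma subspace_par:
  fixes C :: "'a::euclidean_space set"
  assumes "C \<noteq> {}"
  shows "subspace (par C)"
proof -
  obtain c where c: "c \<in> affine hull C" using assms hull_inc by fastforce
  have aff: "affine (affine hull C)" by simp
  have "par C = (\<lambda>x. x - c) ` (affine hull C)"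
  proof
    show "par C \<subseteq> (\<lambda>x. x - c) ` (affine hull C)"
    proof
      fix w assume "w \<in> par C"
      then obtain a b where ab: "a \<in> affine hull C" "b \<in> affine hull C" "w = a - b"
        by (auto simp: par_def)
      have "c + 1 *\<^sub>R (a - b) \<in> affine hull C" using mem_affine_3_minus[OF aff c ab(1,2)] .
      then show "w \<in> (\<lambda>x. x - c) ` (affine hull C)" using ab(3) by (auto intro!: image_eqI[of _ _ "c + (a - b)"])
    qed
  qed (use c in \<open>auto simp: par_def\<close>)
  then show ?thesis using affine_diffs_subspace_subtract[OF aff c] by simp
qed

lemma diff_mem_par: "a \<in> C \<Longrightarrow> b \<in> C \<Longrightarrow> a - b \<in> par C"
  unfolding par_def using hull_inc[of _ C affine] by blast

lemma subspace_model_subspace: "subspace (model_subspace R x)"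
  unfolding model_subspace_def by (rule subspace_orthogonal_comp)

lemma orthogonal_comp_model_subspace:
  "subdifferential R x \<noteq> {} \<Longrightarrow> orthogonal_comp (model_subspace R x) = par (subdifferential R x)"
  unfolding model_subspace_def by (intro orthogonal_comp_self subspace_par)

lemma mem_model_subspace_iff:
  "h \<in> model_subspace R x \<longleftrightarrow> (\<forall>g\<in>subdifferential R x. \<forall>g'\<in>subdifferential R x. (g - g') \<bullet> h = 0)"
  (is "?L \<longleftrightarrow> ?Q")
proof
  assume ?L then show ?Q
    using diff_mem_par by (fastforce simp: model_subspace_def orthogonal_comp_def orthogonal_def)
next
  assume Q: ?Q
  show ?L
  proof (cases "subdifferential R x = {}")
    case True
    then show ?thesis by (simp add: model_subspace_def par_def orthogonal_comp_def)
  next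
    case False
    then obtain g0 where g0: "g0 \<in> subdifferential R x" by auto
    have "(g - g0) \<bullet> h = 0" if "g \<in> subdifferential R x" for g using Q g0 that by blast
    then have "affine hull (subdifferential R x) \<subseteq> {a. h \<bullet> a = h \<bullet> g0}"
      by (intro hull_minimal affine_hyperplane) (auto simp: inner_diff_left inner_commute[of h])
    then have sub: "a \<bullet> h = g0 \<bullet> h" if "a \<in> affine hull (subdifferential R x)" for a
      using that by (auto simp: inner_commute)
    have eq: "a \<bullet> h = b \<bullet> h"
      if "a \<in> affine hull (subdifferential R x)" "b \<in> affine hull (subdifferential R x)" for a b
      using sub[OF that(1)] sub[OF that(2)] by simp
    show ?thesis
      unfolding model_subspace_def par_def orthogonal_comp_def orthogonal_def
      by (auto simp: inner_diff_left intro!: eq)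
  qed
qed

lemma rel_interior_perturb:
  fixes C :: "'a::euclidean_space set"
  assumes "g \<in> rel_interior C" "w \<in> par C"
  obtains e where "e > 0" "\<And>t. \<bar>t\<bar> \<le> e \<Longrightarrow> g + t *\<^sub>R w \<in> C"
proof -
  obtain d where d: "d > 0" "cball g d \<inter> affine hull C \<subseteq> C" "g \<in> C"
    using assms(1) by (auto simp: mem_rel_interior_cball)
  obtain a b where ab: "a \<in> affine hull C" "b \<in> affine hull C" "w = a - b"
    using assms(2) by (auto simp: par_def)
  show ?thesis
  proof
    show "d / (norm w + 1) > 0" using d(1) by (simp add: add_nonneg_pos)
    fix t assume t: "\<bar>t\<bar> \<le> d / (norm w + 1)"
    have "\<bar>t\<bar> * norm w \<le> \<bar>t\<bar> * (norm w + 1)" by (simp add: mult_left_mono)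
    also have "\<dots> \<le> d" using t by (simp add: pos_le_divide_eq add_nonneg_pos)
    finally have "g + t *\<^sub>R w \<in> cball g d" by (simp add: dist_norm)
    moreover have "g + t *\<^sub>R w \<in> affine hull C"
      unfolding ab(3) by (rule mem_affine_3_minus[OF _ hull_inc[OF d(3)] ab(1,2)]) simp
    ultimately show "g + t *\<^sub>R w \<in> C" using d(2) by blast
  qed
qed

lemma velocity_in_subspace:
  fixes c :: "real \<Rightarrow> 'a::euclidean_space"
  assumes c: "(c has_vector_derivative v) (at 0)" and S: "subspace S"
    and ev: "\<forall>\<^sub>F t in nhds 0. c t - c 0 \<in> S"
  shows "v \<in> S"
proof -
  have "w \<bullet> v = 0" if w: "w \<in> orthogonal_comp S" for w
  proof -
    have 1: "((\<lambda>t. w \<bullet> c t) has_vector_derivative (w \<bullet> v)) (at 0)"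
      by (rule bounded_linear.has_vector_derivative[OF bounded_linear_inner_right c])
    obtain N where N: "open N" "0 \<in> N" "\<And>t. t \<in> N \<Longrightarrow> c t - c 0 \<in> S"
      using ev by (auto simp: eventually_nhds)
    have "w \<bullet> c t = w \<bullet> c 0" if "t \<in> N" for t
      using w N(3)[OF that] by (auto simp: orthogonal_comp_def orthogonal_def inner_diff_right inner_commute)
    then have "((\<lambda>t. w \<bullet> c 0) has_vector_derivative (w \<bullet> v)) (at 0)"
      by (intro has_vector_derivative_transform_within_open[OF 1 N(1,2)]) simp
    then show ?thesis using vector_derivative_unique_at has_vector_derivative_const by blast
  qed
  then have "v \<in> orthogonal_comp (orthogonal_comp S)"
    by (auto simp: orthogonal_comp_def[of "orthogonal_comp S"] orthogonal_def)
  then show ?thesis using orthogonal_comp_self[OF S] by simp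
qed

lemma C2_submanifold_around_near:
  assumes "C2_submanifold_around M x"
  shows "\<forall>\<^sub>F y in nhds x. y \<in> M \<longrightarrow> C2_submanifold_around M y"
proof -
  obtain U W \<phi> and \<psi> :: "'a \<Rightarrow> 'a" and S where *: "open U" "x \<in> U" "open W" "subspace S"
        "homeomorphism U W \<phi> \<psi>" "C2_on U \<phi>" "C2_on W \<psi>" "\<phi> ` (M \<inter> U) = S \<inter> W"
    using assms unfolding C2_submanifold_around_def by blast
  have "\<forall>\<^sub>F y in nhds x. y \<in> U" using * eventually_nhds_in_open by blast
  then show ?thesis
    by eventually_elim (use * in \<open>unfold C2_submanifold_around_def, blast\<close>)
qed

lemma C2_along_around_near:
  assumes "C2_along_around J M x"
  shows "\<forall>\<^sub>F y in nhds x. C2_along_around J M y"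
proof -
  obtain U g where *: "open U" "x \<in> U" "C2_on U g" "\<forall>y\<in>M \<inter> U. J y = ereal (g y)"
    using assms unfolding C2_along_around_def by blast
  have "\<forall>\<^sub>F y in nhds x. y \<in> U" using * eventually_nhds_in_open by blast
  then show ?thesis
    by eventually_elim (use * in \<open>unfold C2_along_around_def, blast\<close>)
qed

lemma C2_on_strict_derivative:
  fixes f :: "'a::real_normed_vector \<Rightarrow> 'b::real_normed_vector"
  assumes "open W" "C2_on W f" "w \<in> W"
  obtains L where "(f has_derivative L) (at w)"
    "\<forall>e>0. \<exists>d>0. ball w d \<subseteq> W \<and>
       (\<forall>a\<in>ball w d. \<forall>b\<in>ball w d. norm (f a - f b - L (a - b)) \<le> e * norm (a - b))"
proof -
  obtain f' :: "'a \<Rightarrow> 'a \<Rightarrow>\<^sub>L 'b" and f'' :: "'a \<Rightarrow> 'a \<Rightarrow>\<^sub>L 'a \<Rightarrow>\<^sub>L 'b" where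
    f': "\<And>x. x \<in> W \<Longrightarrow> (f has_derivative f' x) (at x)"
    and f'': "\<And>x. x \<in> W \<Longrightarrow> (f' has_derivative f'' x) (at x)"
    using assms(2) unfolding C2_on_def by blast
  have "isCont f' w" using f''[OF assms(3)] has_derivative_continuous by blast
  show ?thesis
  proof (intro that allI impI)
    show "(f has_derivative f' w) (at w)" using f' assms by blast
    fix e :: real assume e: "e > 0"
    obtain d1 where d1: "d1 > 0" "\<And>y. dist y w < d1 \<Longrightarrow> dist (f' y) (f' w) < e"
      using \<open>isCont f' w\<close> e unfolding continuous_at_eps_delta by blast
    obtain d2 where d2: "d2 > 0" "ball w d2 \<subseteq> W" using assms open_contains_ball by blast
    define d where "d = min d1 d2"
    have d: "d > 0" "ball w d \<subseteq> W" "\<And>y. y \<in> ball w d \<Longrightarrow> norm (f' y - f' w) \<le> e"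
      using d1 d2 by (auto simp: d_def dist_norm norm_minus_commute less_imp_le subset_iff)
    have "norm (f a - f b - f' w (a - b)) \<le> e * norm (a - b)"
      if ab: "a \<in> ball w d" "b \<in> ball w d" for a b
    proof -
      have "norm (f a - f b - f' w (a - b)) \<le> norm (a - b) * e"
      proof (rule differentiable_bound_linearization[where S = "ball w d" and f' = "\<lambda>x. blinfun_apply (f' x)"])
        fix t :: real assume "t \<in> {0..1}"
        then show "b + t *\<^sub>R (a - b) \<in> ball w d"
          using convexD_alt[OF convex_ball ab(2,1), of t] by (simp add: algebra_simps)
      next
        fix y assume y: "y \<in> ball w d"
        then show "(f has_derivative blinfun_apply (f' y)) (at y within ball w d)"
          using f' d(2) has_derivative_at_withinI by blast
        have "onorm (\<lambda>i. blinfun_apply (f' y) i - blinfun_apply (f' w) i) = norm (f' y - f' w)"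
          by (simp add: norm_blinfun.rep_eq minus_blinfun.rep_eq)
        then show "onorm (blinfun_apply (f' y) - blinfun_apply (f' w)) \<le> e"
          using d(3)[OF y] by (simp add: fun_diff_def)
      qed (use d in simp)
      then show ?thesis by (simp add: mult.commute)
    qed
    then show "\<exists>d>0. ball w d \<subseteq> W \<and> (\<forall>a\<in>ball w d. \<forall>b\<in>ball w d.
        norm (f a - f b - blinfun_apply (f' w) (a - b)) \<le> e * norm (a - b))"
      using d(1,2) by blast
  qed
qed

lemma inverse_derivatives:
  fixes f :: "'a::real_normed_vector \<Rightarrow> 'b::real_normed_vector"
  assumes "open U" "x \<in> U" "\<And>y. y \<in> U \<Longrightarrow> g (f y) = y"
    and f: "(f has_derivative f') (at x)" and g: "(g has_derivative g') (at (f x))"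
  shows "g' (f' v) = v"
proof -
  have "((g \<circ> f) has_derivative (g' \<circ> f')) (at x)" by (rule diff_chain_at[OF f g])
  then have "((\<lambda>y. y) has_derivative (g' \<circ> f')) (at x)"
    by (rule has_derivative_transform_within_open[OF _ assms(1,2)]) (simp add: assms(3))
  then have "g' \<circ> f' = (\<lambda>y. y)" using has_derivative_ident has_derivative_unique by blast
  then show ?thesis by (metis comp_apply)
qed

lemma C2_submanifold_chart:
  fixes M :: "'a::euclidean_space set"
  assumes "C2_submanifold_around M x"
  obtains U W \<phi> \<psi> L and S :: "'a set" where "open U" "x \<in> U" "open W" "subspace S"
    "homeomorphism U W \<phi> \<psi>" "\<phi> ` (M \<inter> U) = S \<inter> W" "linear L" "inj L" "tangent_space M x \<subseteq> L ` S"
    "\<forall>e>0. \<exists>d>0. ball (\<phi> x) d \<subseteq> W \<and>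
       (\<forall>a\<in>ball (\<phi> x) d. \<forall>b\<in>ball (\<phi> x) d. norm (\<psi> a - \<psi> b - L (a - b)) \<le> e * norm (a - b))"
proof -
  obtain U W \<phi> and \<psi> :: "'a \<Rightarrow> 'a" and S where *: "open U" "x \<in> U" "open W" "subspace S"
        "homeomorphism U W \<phi> \<psi>" "C2_on U \<phi>" "C2_on W \<psi>" "\<phi> ` (M \<inter> U) = S \<inter> W"
    using assms unfolding C2_submanifold_around_def by blast
  have xM: "x \<in> M" using assms by (simp add: C2_submanifold_around_def)
  have \<psi>\<phi>: "\<psi> (\<phi> y) = y" if "y \<in> U" for y using *(5) that by (simp add: homeomorphism_def)
  have \<phi>\<psi>: "\<phi> (\<psi> y) = y" if "y \<in> W" for y using *(5) that by (simp add: homeomorphism_def)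
  have \<phi>x: "\<phi> x \<in> W" using *(2,5) by (auto simp: homeomorphism_def)
  obtain D where D: "(\<phi> has_derivative D) (at x)"
    by (rule C2_on_strict_derivative[OF *(1,6,2)])
  obtain L where L: "(\<psi> has_derivative L) (at (\<phi> x))"
    and strict: "\<forall>e>0. \<exists>d>0. ball (\<phi> x) d \<subseteq> W \<and>
       (\<forall>a\<in>ball (\<phi> x) d. \<forall>b\<in>ball (\<phi> x) d. norm (\<psi> a - \<psi> b - L (a - b)) \<le> e * norm (a - b))"
    by (rule C2_on_strict_derivative[OF *(3,7) \<phi>x]) blast
  have LD: "L (D v) = v" for v
    using inverse_derivatives[OF *(1,2) \<psi>\<phi> D L] by blast
  have DL: "D (L v) = v" for v
    using inverse_derivatives[OF *(3) \<phi>x \<phi>\<psi> L] D \<psi>\<phi>[OF *(2)] by simp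
  have tan: "v \<in> L ` S" if v: "v \<in> tangent_space M x" for v
  proof -
    obtain c e where c: "e > 0" "c ` {-e<..<e} \<subseteq> M" "c 0 = x" "(c has_vector_derivative v) (at 0)"
      using v by (auto simp: tangent_space_def)
    have "((\<phi> \<circ> c) has_vector_derivative D v) (at 0)"
      by (rule vector_derivative_diff_chain_within[OF c(4)]) (simp add: c(3) has_derivative_at_withinI[OF D])
    moreover have "\<forall>\<^sub>F t in nhds 0. (\<phi> \<circ> c) t - (\<phi> \<circ> c) 0 \<in> S"
    proof -
      have "isCont c 0" using c(4) has_vector_derivative_continuous by blast
      then have "(c \<longlongrightarrow> c 0) (nhds 0)" by (simp only: isCont_def tendsto_at_iff_tendsto_nhds)
      then have "(c \<longlongrightarrow> x) (nhds 0)" by (simp only: c(3))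
      then have "\<forall>\<^sub>F t in nhds 0. c t \<in> U" using *(1,2) by (rule topological_tendstoD)
      moreover have "\<forall>\<^sub>F t in nhds 0. t \<in> {-e<..<e}" using c(1) by (intro eventually_nhds_in_open) auto
      ultimately show ?thesis
      proof eventually_elim
        case (elim t)
        then have "\<phi> (c t) \<in> S" "\<phi> x \<in> S" using c(2) *(2,8) xM by blast+
        then show ?case using *(4) c(3) by (simp add: subspace_diff)
      qed
    qed
    ultimately have "D v \<in> S" by (rule velocity_in_subspace[OF _ *(4)])
    then show ?thesis using LD by (metis image_eqI)
  qed
  show ?thesis
  proof (rule that[OF *(1-5,8) _ _ _ strict])
    show "linear L" using L has_derivative_linear by blast
    show "inj L" using DL by (metis injI)
  qed (use tan in auto)
qed

section \<open>Identification\<close>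

lemma closest_point_subspace_orthogonal:
  fixes S :: "'a::euclidean_space set"
  assumes S: "subspace S"
  shows "a - closest_point S a \<in> orthogonal_comp S"
proof -
  have cl: "convex S" "closed S" "S \<noteq> {}"
    using S subspace_0[OF S] by (auto simp: subspace_imp_convex closed_subspace)
  define p where "p = closest_point S a"
  have p: "p \<in> S" unfolding p_def using cl by (simp add: closest_point_in_set)
  have "(a - p) \<bullet> v \<le> 0" if "v \<in> S" for v
    using closest_point_dot[OF cl(1,2), of "p + v" a] subspace_add[OF S p that] by (simp add: p_def)
  from this this[of "- v" for v] have "(a - p) \<bullet> v = 0" if "v \<in> S" for v
    using that subspace_neg[OF S] by (metis antisym inner_minus_right neg_le_0_iff_le)
  then show ?thesis by (auto simp: orthogonal_comp_def orthogonal_def p_def inner_commute)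
qed

text \<open>
  Projecting onto the slice \<open>S\<close> in a chart moves a point \<open>y\<close> off \<open>M\<close> to a point \<open>p\<close> of \<open>M\<close>; in the
  chart the rescaled differences are orthogonal to \<open>S\<close>, so \<open>n\<close> is the image of a unit vector of the
  orthogonal complement of \<open>S\<close>.
\<close>
lemma submanifold_transversal_approximation:
  fixes M :: "'a::euclidean_space set"
  assumes M: "C2_submanifold_around M x" and y: "y \<longlonglongrightarrow> x" and off: "\<And>k. y k \<notin> M"
  obtains r :: "nat \<Rightarrow> nat" and p \<tau> n where "strict_mono r" "p \<longlonglongrightarrow> x"
    "\<forall>\<^sub>F k in sequentially. p k \<in> M" "\<forall>\<^sub>F k in sequentially. \<tau> k > 0"
    "(\<lambda>k. (1 / \<tau> k) *\<^sub>R (y (r k) - p k)) \<longlonglongrightarrow> n" "n \<notin> tangent_space M x"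
proof -
  obtain U W \<phi> \<psi> L and S :: "'a set" where *: "open U" "x \<in> U" "open W" "subspace S"
    "homeomorphism U W \<phi> \<psi>" "\<phi> ` (M \<inter> U) = S \<inter> W" "linear L" "inj L" "tangent_space M x \<subseteq> L ` S"
    and strict: "\<forall>e>0. \<exists>d>0. ball (\<phi> x) d \<subseteq> W \<and>
       (\<forall>a\<in>ball (\<phi> x) d. \<forall>b\<in>ball (\<phi> x) d. norm (\<psi> a - \<psi> b - L (a - b)) \<le> e * norm (a - b))"
    by (rule C2_submanifold_chart[OF M]) blast
  have xM: "x \<in> M" using M by (simp add: C2_submanifold_around_def)
  have \<psi>\<phi>: "\<psi> (\<phi> y) = y" if "y \<in> U" for y using *(5) that by (simp add: homeomorphism_def)
  have \<phi>x: "\<phi> x \<in> S" "\<phi> x \<in> W" using *(2,6) xM by blast+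
  have cl: "convex S" "closed S" "S \<noteq> {}"
    using *(4) subspace_0[OF *(4)] by (auto simp: subspace_imp_convex closed_subspace)
  define a where "a k = \<phi> (y k)" for k
  define b where "b k = closest_point S (a k)" for k
  have "isCont \<phi> x"
    using *(1,2,5) by (simp add: homeomorphism_def continuous_on_eq_continuous_at)
  then have a: "a \<longlonglongrightarrow> \<phi> x" unfolding a_def using y by (rule isCont_tendsto_compose)
  have "b \<longlonglongrightarrow> closest_point S (\<phi> x)"
    unfolding b_def using continuous_at_closest_point[OF cl] a by (rule isCont_tendsto_compose)
  then have b: "b \<longlonglongrightarrow> \<phi> x" using \<phi>x by (simp add: closest_point_self)
  have "isCont \<psi> (\<phi> x)"
    using *(3,5) \<phi>x by (simp add: homeomorphism_def continuous_on_eq_continuous_at)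
  then have \<psi>b: "(\<lambda>k. \<psi> (b k)) \<longlonglongrightarrow> x"
    using isCont_tendsto_compose[OF _ b] \<psi>\<phi>[OF *(2)] by fastforce
  have evU: "\<forall>\<^sub>F k in sequentially. y k \<in> U" using topological_tendstoD[OF y *(1,2)] .
  have evW: "\<forall>\<^sub>F k in sequentially. b k \<in> W" using topological_tendstoD[OF b *(3) \<phi>x(2)] .
  have bS: "b k \<in> S" for k unfolding b_def using cl by (simp add: closest_point_in_set)
  have inM: "\<psi> s \<in> M" if "s \<in> S" "s \<in> W" for s
  proof -
    obtain m where "m \<in> M" "m \<in> U" "s = \<phi> m" using \<open>s \<in> S\<close> \<open>s \<in> W\<close> *(6) by blast
    then show ?thesis using \<psi>\<phi> by simp
  qed
  have pM: "\<forall>\<^sub>F k in sequentially. \<psi> (b k) \<in> M"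
    using evW by eventually_elim (use inM bS in blast)
  have ne: "\<forall>\<^sub>F k in sequentially. a k \<noteq> b k"
    using evU evW
  proof eventually_elim
    case (elim k)
    show ?case
    proof
      assume "a k = b k"
      then have "\<psi> (a k) \<in> M" using inM bS elim by simp
      then show False using \<psi>\<phi>[of "y k"] elim off by (simp add: a_def)
    qed
  qed
  define s where "s k = sgn (a k - b k)" for k
  have "norm (s k) \<le> 1" for k by (simp add: s_def norm_sgn)
  then have "bounded (range s)" by (auto simp: bounded_iff)
  then obtain s0 r where r: "strict_mono (r :: nat \<Rightarrow> nat)" "(s \<circ> r) \<longlonglongrightarrow> s0"
    using bounded_imp_convergent_subsequence by blast
  have sr: "(\<lambda>k. s (r k)) \<longlonglongrightarrow> s0" using r(2) by (simp add: o_def)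
  have sub: "(\<lambda>k. f (r k)) \<longlonglongrightarrow> l" if "f \<longlonglongrightarrow> l" for f :: "nat \<Rightarrow> 'a" and l
    using LIMSEQ_subseq_LIMSEQ[OF that r(1)] by (simp add: o_def)
  have evr: "\<forall>\<^sub>F k in sequentially. P (r k)" if "\<forall>\<^sub>F k in sequentially. P k" for P
    using that r(1) by (rule eventually_subseq[rotated])
  have ner: "\<forall>\<^sub>F k in sequentially. a (r k) \<noteq> b (r k)" using evr[OF ne] .
  have sS: "s k \<in> orthogonal_comp S" for k
    using closest_point_subspace_orthogonal[OF *(4), of "a k"]
    by (simp add: s_def b_def sgn_div_norm subspace_mul subspace_orthogonal_comp)
  have s0: "s0 \<in> orthogonal_comp S"
    by (rule closed_sequentially[OF closed_subspace[OF subspace_orthogonal_comp] _ sr]) (simp add: sS)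
  have "(\<lambda>k. norm (s (r k))) \<longlonglongrightarrow> 1"
    by (rule tendsto_eventually) (use ner in eventually_elim, simp add: s_def norm_sgn)
  then have s01: "norm s0 = 1" using tendsto_norm[OF sr] LIMSEQ_unique by blast
  define \<tau> where "\<tau> k = norm (a (r k) - b (r k))" for k
  define p where "p k = \<psi> (b (r k))" for k
  have lin: "bounded_linear L" using *(7) linear_conv_bounded_linear by blast
  have "(\<lambda>k. (1 / \<tau> k) *\<^sub>R (y (r k) - p k) - L (s (r k))) \<longlonglongrightarrow> 0"
    unfolding tendsto_iff
  proof (intro allI impI)
    fix e :: real assume "e > 0"
    then obtain d where d: "d > 0" "ball (\<phi> x) d \<subseteq> W"
      "\<forall>a\<in>ball (\<phi> x) d. \<forall>b\<in>ball (\<phi> x) d. norm (\<psi> a - \<psi> b - L (a - b)) \<le> e / 2 * norm (a - b)"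
      using strict by (metis half_gt_zero)
    have "\<forall>\<^sub>F k in sequentially. a (r k) \<in> ball (\<phi> x) d"
      by (rule topological_tendstoD[OF sub[OF a]]) (use d in auto)
    moreover have "\<forall>\<^sub>F k in sequentially. b (r k) \<in> ball (\<phi> x) d"
      by (rule topological_tendstoD[OF sub[OF b]]) (use d in auto)
    ultimately show "\<forall>\<^sub>F k in sequentially. dist ((1 / \<tau> k) *\<^sub>R (y (r k) - p k) - L (s (r k))) 0 < e"
      using ner evr[OF evU]
    proof eventually_elim
      case (elim k)
      have \<tau>: "\<tau> k > 0" using elim(3) by (simp add: \<tau>_def)
      have yk: "\<psi> (a (r k)) = y (r k)" using \<psi>\<phi>[OF elim(4)] by (simp add: a_def)
      have "L (s (r k)) = (1 / \<tau> k) *\<^sub>R L (a (r k) - b (r k))"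
        by (simp add: s_def sgn_div_norm \<tau>_def linear_scale[OF *(7)] inverse_eq_divide)
      then have "norm ((1 / \<tau> k) *\<^sub>R (y (r k) - p k) - L (s (r k)))
          = (1 / \<tau> k) * norm (\<psi> (a (r k)) - \<psi> (b (r k)) - L (a (r k) - b (r k)))"
        using \<tau> by (simp add: yk p_def flip: scaleR_diff_right)
      also have "\<dots> \<le> (1 / \<tau> k) * (e / 2 * \<tau> k)"
        using d(3) elim(1,2) \<tau> unfolding \<tau>_def by (intro mult_left_mono) auto
      also have "\<dots> = e / 2" using \<tau> by simp
      finally show ?case using \<open>e > 0\<close> by simp
    qed
  qed
  then have "(\<lambda>k. (1 / \<tau> k) *\<^sub>R (y (r k) - p k) - L (s (r k)) + L (s (r k))) \<longlonglongrightarrow> 0 + L s0"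
    by (rule tendsto_add) (rule bounded_linear.tendsto[OF lin sr])
  then have lim: "(\<lambda>k. (1 / \<tau> k) *\<^sub>R (y (r k) - p k)) \<longlonglongrightarrow> L s0" by simp
  have "s0 \<notin> S"
  proof
    assume "s0 \<in> S"
    then have "s0 \<bullet> s0 = 0" using s0 by (auto simp: orthogonal_comp_def orthogonal_def)
    then show False using s01 by simp
  qed
  then have "L s0 \<notin> tangent_space M x" using *(8,9) by (auto dest: injD)
  show ?thesis
  proof (rule that[OF r(1) _ _ _ lim])
    show "L s0 \<notin> tangent_space M x" by fact
    show "p \<longlonglongrightarrow> x" unfolding p_def using sub[OF \<psi>b] .
    show "\<forall>\<^sub>F k in sequentially. p k \<in> M" unfolding p_def using evr[OF pM] .
    show "\<forall>\<^sub>F k in sequentially. \<tau> k > 0"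
      using ner by eventually_elim (simp add: \<tau>_def)
  qed
qed

lemma partly_smooth_identification:
  fixes R :: "'a::euclidean_space \<Rightarrow> ereal"
  assumes proper: "proper_fun R" and ps: "partly_smooth_at R x M"
    and y: "y \<longlonglongrightarrow> x" and h: "\<And>k. h k \<in> subdifferential R (y k)" "h \<longlonglongrightarrow> g"
    and g: "g \<in> rel_interior (subdifferential R x)"
  shows "\<forall>\<^sub>F k in sequentially. y k \<in> M"
proof (rule ccontr)
  assume "\<not> ?thesis"
  then have "\<exists>\<^sub>F k in sequentially. y k \<notin> M" by (simp add: frequently_def)
  then have "infinite {k. y k \<notin> M}" by (simp add: frequently_cofinite flip: cofinite_eq_sequentially)
  then obtain q where q: "strict_mono (q :: nat \<Rightarrow> nat)" "\<And>k. y (q k) \<notin> M"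
    using infinite_enumerate by blast
  have yq: "(\<lambda>k. y (q k)) \<longlonglongrightarrow> x" using LIMSEQ_subseq_LIMSEQ[OF y q(1)] by (simp add: o_def)
  have ps': "C2_submanifold_around M x" "tangent_space M x = model_subspace R x"
    "setvalued_continuous_at (subdifferential R) M x" "subdifferential R x \<noteq> {}"
    using ps by (auto simp: partly_smooth_at_def)
  obtain r :: "nat \<Rightarrow> nat" and p \<tau> n where r: "strict_mono r" "p \<longlonglongrightarrow> x"
    and pM: "\<forall>\<^sub>F k in sequentially. p k \<in> M" and \<tau>: "\<forall>\<^sub>F k in sequentially. \<tau> k > 0"
    and lim: "(\<lambda>k. (1 / \<tau> k) *\<^sub>R (y (q (r k)) - p k)) \<longlonglongrightarrow> n" and n: "n \<notin> tangent_space M x"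
    by (rule submanifold_transversal_approximation[OF ps'(1) yq q(2)])
  have "n \<notin> orthogonal_comp (par (subdifferential R x))"
    using n ps'(2) by (simp add: model_subspace_def)
  then obtain w where w: "w \<in> par (subdifferential R x)" "w \<bullet> n \<noteq> 0"
    by (auto simp: orthogonal_comp_def orthogonal_def)
  obtain e where e: "e > 0" "\<And>t. \<bar>t\<bar> \<le> e \<Longrightarrow> g + t *\<^sub>R w \<in> subdifferential R x"
    using rel_interior_perturb[OF g w(1)] by blast
  define t where "t = e * sgn (w \<bullet> n)"
  have t: "g + t *\<^sub>R w \<in> subdifferential R x"
    by (rule e(2)) (use e(1) in \<open>simp add: t_def abs_mult abs_sgn_eq\<close>)
  have pos: "t * (w \<bullet> n) > 0"
    using e(1) w(2) by (auto simp: t_def sgn_real_def zero_less_mult_iff mult_less_0_iff)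
  define \<delta> where "\<delta> = t * (w \<bullet> n) / (norm n + 1)"
  have \<delta>: "\<delta> > 0" using pos by (simp add: \<delta>_def add_nonneg_pos)
  define N where "N k = (1 / \<tau> k) *\<^sub>R (y (q (r k)) - p k)" for k
  have ev: "\<forall>\<^sub>F k in sequentially. p k \<in> M \<longrightarrow> (\<exists>f\<in>subdifferential R (p k). dist f (g + t *\<^sub>R w) < \<delta>)"
    using setvalued_inner_continuity[OF ps'(3) t \<delta>] r(2) by (rule eventually_compose_filterlim)
  have "\<forall>\<^sub>F k in sequentially. - \<delta> * norm (N k) \<le> (h (q (r k)) - (g + t *\<^sub>R w)) \<bullet> N k"
    using ev pM \<tau>
  proof eventually_elim
    case (elim k)
    then obtain f where f: "f \<in> subdifferential R (p k)" "dist f (g + t *\<^sub>R w) < \<delta>" by blast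
    have "0 \<le> (h (q (r k)) - f) \<bullet> (y (q (r k)) - p k)"
      by (rule subdifferential_monotone[OF proper h(1) f(1)])
    then have 1: "0 \<le> (h (q (r k)) - f) \<bullet> N k" using elim(3) by (simp add: N_def)
    have "\<bar>(f - (g + t *\<^sub>R w)) \<bullet> N k\<bar> \<le> norm (f - (g + t *\<^sub>R w)) * norm (N k)"
      by (rule Cauchy_Schwarz_ineq2)
    also have "\<dots> \<le> \<delta> * norm (N k)" using f(2) by (intro mult_right_mono) (auto simp: dist_norm)
    finally have 2: "- \<delta> * norm (N k) \<le> (f - (g + t *\<^sub>R w)) \<bullet> N k" by linarith
    have "(h (q (r k)) - (g + t *\<^sub>R w)) \<bullet> N k = (h (q (r k)) - f) \<bullet> N k + (f - (g + t *\<^sub>R w)) \<bullet> N k"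
      by (simp add: inner_diff_left)
    then show ?case using 1 2 by linarith
  qed
  moreover have hq: "(\<lambda>k. h (q (r k))) \<longlonglongrightarrow> g"
    using LIMSEQ_subseq_LIMSEQ[OF LIMSEQ_subseq_LIMSEQ[OF h(2) q(1)] r(1)] by (simp add: o_def)
  have Nn: "N \<longlonglongrightarrow> n" using lim by (simp add: N_def[abs_def])
  have "(\<lambda>k. - \<delta> * norm (N k)) \<longlonglongrightarrow> - \<delta> * norm n" by (intro tendsto_intros Nn)
  moreover have "(\<lambda>k. (h (q (r k)) - (g + t *\<^sub>R w)) \<bullet> N k) \<longlonglongrightarrow> (g - (g + t *\<^sub>R w)) \<bullet> n"
    by (intro tendsto_intros Nn hq)
  ultimately have "- \<delta> * norm n \<le> (g - (g + t *\<^sub>R w)) \<bullet> n"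
    by (intro tendsto_le[OF sequentially_bot]) 
  then have "t * (w \<bullet> n) \<le> \<delta> * norm n" by (simp add: inner_diff_left inner_add_left)
  moreover have "\<delta> * norm n + \<delta> = t * (w \<bullet> n)"
    by (simp add: \<delta>_def field_simps add_nonneg_eq_0_iff)
  ultimately show False using \<delta> by linarith
qed

section \<open>The affine and the polyhedral case\<close>

lemma model_subspace_locally_constant:
  fixes R :: "'a::euclidean_space \<Rightarrow> ereal"
  assumes proper: "proper_fun R" and ps: "partly_smooth_at R x M"
    and M: "coincide_around x M ((+) x ` model_subspace R x)"
    and g: "g \<in> rel_interior (subdifferential R x)"
  shows "\<forall>\<^sub>F y in nhds x. y \<in> M \<longrightarrow> model_subspace R y = model_subspace R x"
proof -
  define T where "T = model_subspace R x"
  have T: "subspace T" unfolding T_def by (rule subspace_model_subspace)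
  have ps': "C2_along_around R M x" "setvalued_continuous_at (subdifferential R) M x"
    "subdifferential R x \<noteq> {}" using ps by (auto simp: partly_smooth_at_def)
  obtain U f where U: "open U" "x \<in> U" "C2_on U f" "\<And>y. y \<in> M \<Longrightarrow> y \<in> U \<Longrightarrow> R y = ereal (f y)"
    using ps'(1) unfolding C2_along_around_def by blast
  obtain N where N: "open N" "x \<in> N" "M \<inter> N = (+) x ` T \<inter> N"
    using M unfolding coincide_around_def T_def by blast
  have 1: "T \<subseteq> model_subspace R y" if y: "y \<in> M" "y \<in> U \<inter> N" for y
  proof
    fix v assume v: "v \<in> T"
    obtain d where yd: "d \<in> T" "y = x + d" using y N(3) by blast
    have line: "y + t *\<^sub>R v \<in> (+) x ` T" for t
      using yd v T by (auto simp: add.assoc subspace_add subspace_mul)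
    obtain D where D: "(f has_derivative D) (at y)"
      by (rule C2_on_strict_derivative[OF U(1,3)]) (use y(2) in blast)
    have "((\<lambda>t. y + t *\<^sub>R v) has_derivative (\<lambda>t. t *\<^sub>R v)) (at (0::real))"
      by (auto intro!: derivative_eq_intros)
    then have "((\<lambda>t. f (y + t *\<^sub>R v)) has_derivative (\<lambda>t. D (t *\<^sub>R v))) (at 0)"
      by (rule has_derivative_compose) (simp add: D)
    moreover have "D (t *\<^sub>R v) = D v * t" for t using has_derivative_linear[OF D] by (simp add: linear_scale)
    ultimately have der: "((\<lambda>t. f (y + t *\<^sub>R v)) has_real_derivative D v) (at 0)"
      by (simp add: has_field_derivative_def)
    have "open (U \<inter> N)" using U(1) N(1) by blast
    then obtain e where e: "e > 0" "ball y e \<subseteq> U \<inter> N" using y(2) open_contains_ball by blast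
    define d where "d = e / (norm v + 1)"
    have d: "d > 0" using e(1) by (simp add: d_def add_nonneg_pos)
    have near: "R (y + t *\<^sub>R v) = ereal (f (y + t *\<^sub>R v))" if "\<bar>t\<bar> < d" for t
    proof -
      have "\<bar>t\<bar> * norm v \<le> \<bar>t\<bar> * (norm v + 1)" by (simp add: mult_left_mono)
      also have "\<dots> < e" using that by (simp add: d_def pos_less_divide_eq add_nonneg_pos)
      finally have "y + t *\<^sub>R v \<in> U \<inter> N" using e(2) by (auto simp: dist_norm)
      then show ?thesis using line[of t] N(3) U(4) by blast
    qed
    have slope: "h \<bullet> v = D v" if h: "h \<in> subdifferential R y" for h
    proof -
      define \<Delta> where "\<Delta> t = f (y + t *\<^sub>R v) - t * (h \<bullet> v)" for t
      have "(\<Delta> has_real_derivative D v - h \<bullet> v) (at 0)"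
        unfolding \<Delta>_def by (auto intro!: derivative_eq_intros der)
      moreover have "\<Delta> 0 \<le> \<Delta> t" if "\<bar>0 - t\<bar> < d" for t
        using subgradient_ineq[OF h, of "f y" "y + t *\<^sub>R v"] near[of t] near[of 0] that d
        by (simp add: \<Delta>_def)
      ultimately have "D v - h \<bullet> v = 0" using d by (intro DERIV_local_min) auto
      then show ?thesis by simp
    qed
    then show "v \<in> model_subspace R y"
      by (auto simp: mem_model_subspace_iff inner_diff_left)
  qed
  have 2: "\<forall>\<^sub>F y in nhds x. y \<in> M \<longrightarrow> (\<forall>w\<in>orthogonal_comp T. w \<in> model_subspace R y \<longrightarrow> w = 0)"
  proof (rule ccontr)
    assume "\<not> ?thesis"
    then obtain y where y: "y \<longlonglongrightarrow> x"
      "\<And>k. y k \<in> M \<and> (\<exists>w\<in>orthogonal_comp T. w \<in> model_subspace R (y k) \<and> w \<noteq> 0)"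
      by (rule not_eventually_nhds_sequence) blast
    then obtain w where w: "\<And>k. w k \<in> orthogonal_comp T" "\<And>k. w k \<in> model_subspace R (y k)" "\<And>k. w k \<noteq> 0"
      by metis
    define s where "s k = sgn (w k)" for k
    have s: "s k \<in> orthogonal_comp T" "s k \<in> model_subspace R (y k)" "norm (s k) = 1" for k
      using w[of k] by (simp_all add: s_def sgn_div_norm norm_sgn subspace_mul subspace_orthogonal_comp subspace_model_subspace)
    have "bounded (range s)" using s(3) by (auto simp: bounded_iff)
    then obtain s0 r where r: "strict_mono (r :: nat \<Rightarrow> nat)" "(s \<circ> r) \<longlonglongrightarrow> s0"
      using bounded_imp_convergent_subsequence by blast
    have sr: "(\<lambda>k. s (r k)) \<longlonglongrightarrow> s0" using r(2) by (simp add: o_def)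
    have yr: "(\<lambda>k. y (r k)) \<longlonglongrightarrow> x" using LIMSEQ_subseq_LIMSEQ[OF y(1) r(1)] by (simp add: o_def)
    have "s0 \<in> orthogonal_comp T"
      by (rule closed_sequentially[OF closed_subspace[OF subspace_orthogonal_comp] _ sr]) (simp add: s(1))
    then have "s0 \<in> par (subdifferential R x)"
      using orthogonal_comp_model_subspace[OF ps'(3)] by (simp add: T_def)
    then obtain e where e: "e > 0" "\<And>t. \<bar>t\<bar> \<le> e \<Longrightarrow> g + t *\<^sub>R s0 \<in> subdifferential R x"
      using rel_interior_perturb[OF g] by blast
    have lim: "\<exists>h. (\<forall>\<^sub>F k in sequentially. h k \<in> subdifferential R (y (r k))) \<and> h \<longlonglongrightarrow> g'"
      if "g' \<in> subdifferential R x" for g'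
    proof -
      have "g' \<in> inner_limit (subdifferential R) M x"
        using ps'(2) that by (auto simp: setvalued_continuous_at_def)
      then show ?thesis using yr y(2) by (simp add: inner_limit_def)
    qed
    obtain h where h: "\<forall>\<^sub>F k in sequentially. h k \<in> subdifferential R (y (r k))" "h \<longlonglongrightarrow> g"
      using lim[of g] e(2)[of 0] e(1) by auto
    obtain h' where h': "\<forall>\<^sub>F k in sequentially. h' k \<in> subdifferential R (y (r k))" "h' \<longlonglongrightarrow> g + e *\<^sub>R s0"
      using lim[of "g + e *\<^sub>R s0"] e(2)[of e] e(1) by auto
    have "\<forall>\<^sub>F k in sequentially. (h' k - h k) \<bullet> s (r k) = 0"
      using h(1) h'(1) by eventually_elim (use s(2) in \<open>auto simp: mem_model_subspace_iff\<close>)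
    then have "(\<lambda>k. (h' k - h k) \<bullet> s (r k)) \<longlonglongrightarrow> 0" by (rule tendsto_eventually)
    moreover have "(\<lambda>k. (h' k - h k) \<bullet> s (r k)) \<longlonglongrightarrow> (g + e *\<^sub>R s0 - g) \<bullet> s0"
      by (intro tendsto_intros h(2) h'(2) sr)
    ultimately have "(g + e *\<^sub>R s0 - g) \<bullet> s0 = 0" using LIMSEQ_unique by blast
    then have "s0 = 0" using e(1) by simp
    moreover have "norm s0 = 1" using tendsto_norm[OF sr] s(3) by (simp add: LIMSEQ_const_iff)
    ultimately show False by simp
  qed
  have "\<forall>\<^sub>F y in nhds x. y \<in> U \<inter> N" using U N by (intro eventually_nhds_in_open) auto
  with 2 show ?thesis
  proof eventually_elim
    case (elim y)
    show ?case
    proof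
      assume y: "y \<in> M"
      have sub: "T \<subseteq> model_subspace R y" using 1[OF y elim(2)] .
      moreover have "model_subspace R y \<subseteq> T"
      proof
        fix v assume v: "v \<in> model_subspace R y"
        define p where "p = closest_point T v"
        have p: "p \<in> T" unfolding p_def
          using T subspace_0[OF T] by (intro closest_point_in_set) (auto simp: closed_subspace)
        have "v - p \<in> orthogonal_comp T" unfolding p_def by (rule closest_point_subspace_orthogonal[OF T])
        moreover have "v - p \<in> model_subspace R y"
          using v p sub by (intro subspace_diff[OF subspace_model_subspace]) auto
        ultimately have "v - p = 0" using elim(1) y by blast
        then show "v \<in> T" using p by simp
      qed
      ultimately show "model_subspace R y = model_subspace R x" unfolding T_def by blast
    qed
  qed
qed

lemma polyhedron_locally_conic:
  fixes E :: "'a::euclidean_space set"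
  assumes "polyhedron E" "p \<in> E"
  shows "\<forall>\<^sub>F q in nhds p. q \<in> E \<longrightarrow> p + 2 *\<^sub>R (q - p) \<in> E"
proof -
  obtain \<H> where \<H>: "finite \<H>" "E = \<Inter>\<H>" "\<And>h. h \<in> \<H> \<Longrightarrow> \<exists>a b. a \<noteq> 0 \<and> h = {x. a \<bullet> x \<le> b}"
    using assms(1) unfolding polyhedron_def by blast
  have "\<forall>\<^sub>F q in nhds p. q \<in> h \<longrightarrow> p + 2 *\<^sub>R (q - p) \<in> h" if h: "h \<in> \<H>" for h
  proof -
    obtain a b where hab: "h = {x. a \<bullet> x \<le> b}" using \<H>(3)[OF h] by blast
    have "a \<bullet> p \<le> b" using assms(2) h \<H>(2) hab by blast
    then consider "a \<bullet> p = b" | "a \<bullet> p < b" by linarith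
    then show ?thesis
    proof cases
      case 1
      then show ?thesis by (auto simp: hab inner_add_right inner_diff_right)
    next
      case 2
      have "((\<lambda>q. a \<bullet> (p + 2 *\<^sub>R (q - p))) \<longlongrightarrow> a \<bullet> (p + 2 *\<^sub>R (p - p))) (nhds p)"
        by (intro tendsto_intros filterlim_ident)
      then have "\<forall>\<^sub>F q in nhds p. a \<bullet> (p + 2 *\<^sub>R (q - p)) < b"
        by (rule order_tendstoD) (use 2 in simp)
      then show ?thesis by eventually_elim (simp add: hab)
    qed
  qed
  then have "\<forall>\<^sub>F q in nhds p. \<forall>h\<in>\<H>. q \<in> h \<longrightarrow> p + 2 *\<^sub>R (q - p) \<in> h"
    using \<H>(1) by (intro eventually_ball_finite) auto
  then show ?thesis by eventually_elim (auto simp: \<H>(2))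
qed

text \<open>
  The epigraph is conic near \<open>(x, R x)\<close>, so displacements from there can be doubled.  Hence the
  supporting hyperplane at \<open>y\<close> also passes through \<open>(x, R x)\<close>.
\<close>
lemma polyhedral_subgradient_transport:
  fixes R :: "'a::euclidean_space \<Rightarrow> ereal"
  assumes proper: "proper_fun R" and poly: "locally_polyhedral_around R x"
    and g: "g \<in> subdifferential R x"
  shows "\<forall>\<^sub>F y in nhds x. \<forall>h\<in>subdifferential R y. dist h g < 1 \<longrightarrow>
           h \<in> subdifferential R x \<and> R y = R x + ereal (h \<bullet> (y - x))"
proof -
  obtain P where P: "polyhedral_fun P" "\<forall>\<^sub>F y in nhds x. R y = P y"
    using poly unfolding locally_polyhedral_around_def by blast
  obtain r where r: "R x = ereal r" using subgradient_finite[OF proper g] by auto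
  define E where "E = {(y, s). P y \<le> ereal s}"
  have "R x = P x" using P(2) eventually_nhds_x_imp_x by blast
  then have "(x, r) \<in> E" using r by (simp add: E_def)
  moreover have "polyhedron E" using P(1) by (simp add: polyhedral_fun_def E_def)
  ultimately have "\<forall>\<^sub>F q in nhds (x, r). q \<in> E \<longrightarrow> (x, r) + 2 *\<^sub>R (q - (x, r)) \<in> E"
    by (intro polyhedron_locally_conic)
  then obtain \<epsilon> where \<epsilon>: "\<epsilon> > 0"
    "\<And>q. dist q (x, r) < \<epsilon> \<Longrightarrow> q \<in> E \<Longrightarrow> (x, r) + 2 *\<^sub>R (q - (x, r)) \<in> E"
    unfolding eventually_nhds_metric by blast
  obtain d where d: "d > 0" "\<And>y. dist y x < d \<Longrightarrow> R y = P y"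
    using P(2) unfolding eventually_nhds_metric by blast
  define B where "B = norm g + 1"
  have B: "B \<ge> 1" by (simp add: B_def)
  define \<eta> where "\<eta> = min (d / 2) (\<epsilon> / (1 + B))"
  have \<eta>: "\<eta> > 0" using d(1) \<epsilon>(1) B by (simp add: \<eta>_def)
  have "\<forall>h\<in>subdifferential R y. dist h g < 1 \<longrightarrow> h \<in> subdifferential R x \<and> R y = R x + ereal (h \<bullet> (y - x))"
    if y: "dist y x < \<eta>" for y
  proof (intro ballI impI)
    fix h assume h: "h \<in> subdifferential R y" "dist h g < 1"
    obtain s where s: "R y = ereal s" using subgradient_finite[OF proper h(1)] by auto
    have up: "s + h \<bullet> (x - y) \<le> r" using subgradient_ineq[OF h(1) s r] .
    have lo: "r + g \<bullet> (y - x) \<le> s" using subgradient_ineq[OF g r s] .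
    have hB: "norm h \<le> B" using h(2) norm_triangle_ineq2[of h g] by (simp add: B_def dist_norm)
    have bound: "\<bar>f \<bullet> (y - x)\<bar> \<le> B * norm (y - x)" if "norm f \<le> B" for f
      using Cauchy_Schwarz_ineq2[of f "y - x"] mult_right_mono[OF that norm_ge_zero[of "y - x"]] by linarith
    have sr: "\<bar>s - r\<bar> \<le> B * norm (y - x)"
      using up lo bound[OF hB] bound[of g] by (simp add: inner_diff_right abs_le_iff B_def)
    have "dist (y, s) (x, r) \<le> norm (y - x) + \<bar>s - r\<bar>"
      using norm_Pair_le[of "y - x" "s - r"] by (simp add: dist_norm)
    also have "\<dots> \<le> (1 + B) * norm (y - x)" using sr by (simp add: algebra_simps)
    also have "\<dots> < (1 + B) * (\<epsilon> / (1 + B))"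
      using y B by (intro mult_strict_left_mono) (auto simp: \<eta>_def dist_norm)
    also have "\<dots> = \<epsilon>" using B by simp
    finally have "dist (y, s) (x, r) < \<epsilon>" .
    moreover have "(y, s) \<in> E" using s d(2)[of y] y d(1) by (simp add: E_def \<eta>_def)
    ultimately have "(x, r) + 2 *\<^sub>R ((y, s) - (x, r)) \<in> E" by (rule \<epsilon>(2))
    then have "P (x + 2 *\<^sub>R (y - x)) \<le> ereal (r + 2 * (s - r))" by (simp add: E_def)
    moreover have "R (x + 2 *\<^sub>R (y - x)) = P (x + 2 *\<^sub>R (y - x))"
      using y by (intro d(2)) (simp add: dist_norm \<eta>_def)
    ultimately have le: "R (x + 2 *\<^sub>R (y - x)) \<le> ereal (r + 2 * (s - r))" by simp
    moreover have "R y + ereal (h \<bullet> (x + 2 *\<^sub>R (y - x) - y)) \<le> R (x + 2 *\<^sub>R (y - x))"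
      using h(1) by (auto simp: subdifferential_def)
    ultimately have "R y + ereal (h \<bullet> (x + 2 *\<^sub>R (y - x) - y)) \<le> ereal (r + 2 * (s - r))"
      by (rule order_trans[rotated])
    moreover have "x + 2 *\<^sub>R (y - x) - y = y - x" by (simp add: algebra_simps scaleR_2)
    ultimately have "s + h \<bullet> (y - x) \<le> r + 2 * (s - r)" using s by simp
    then have eq: "s = r + h \<bullet> (y - x)" using up by (simp add: inner_diff_right)
    have "R x + ereal (h \<bullet> (w - x)) \<le> R w" for w
    proof -
      have "R y + ereal (h \<bullet> (w - y)) \<le> R w" using h(1) by (auto simp: subdifferential_def)
      moreover have "R y + ereal (h \<bullet> (w - y)) = R x + ereal (h \<bullet> (w - x))"
        using s r eq by (simp add: inner_diff_right)
      ultimately show ?thesis by simp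
    qed
    then show "h \<in> subdifferential R x \<and> R y = R x + ereal (h \<bullet> (y - x))"
      using s r eq by (simp add: subdifferential_def)
  qed
  then show ?thesis unfolding eventually_nhds_metric using \<eta> by blast
qed

lemma polyhedral_active_manifold:
  fixes R :: "'a::euclidean_space \<Rightarrow> ereal"
  assumes proper: "proper_fun R" and ps: "partly_smooth_at R x M"
    and poly: "locally_polyhedral_around R x"
    and g: "g \<in> rel_interior (subdifferential R x)"
  shows "\<forall>\<^sub>F y in nhds x. y \<in> M \<longrightarrow>
           y - x \<in> model_subspace R x \<and> R y = R x + ereal (g \<bullet> (y - x))"
proof -
  have gC: "g \<in> subdifferential R x" using g rel_interior_subset by blast
  have cont: "setvalued_continuous_at (subdifferential R) M x"
    using ps by (auto simp: partly_smooth_at_def)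
  obtain e where e: "e > 0" "cball g e \<inter> affine hull (subdifferential R x) \<subseteq> subdifferential R x"
    using g by (auto simp: mem_rel_interior_cball)
  define \<delta> where "\<delta> = min 1 (e / 2)"
  have \<delta>: "\<delta> > 0" using e(1) by (simp add: \<delta>_def)
  show ?thesis
    using setvalued_inner_continuity[OF cont gC \<delta>] polyhedral_subgradient_transport[OF proper poly gC]
  proof eventually_elim
    case (elim y)
    show ?case
    proof
      assume "y \<in> M"
      then obtain h where h: "h \<in> subdifferential R y" "dist h g < \<delta>" using elim(1) by blast
      then have hx: "h \<in> subdifferential R x" and Ry: "R y = R x + ereal (h \<bullet> (y - x))"
        using elim(2) by (auto simp: \<delta>_def)
      have "cball h (e / 2) \<subseteq> cball g e"
        using h(2) by (auto simp: \<delta>_def cball_subset_cball_iff dist_commute)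
      then have hri: "h \<in> rel_interior (subdifferential R x)"
        using hx e by (auto simp: mem_rel_interior_cball intro!: exI[of _ "e / 2"])
      obtain r where r: "R x = ereal r" using subgradient_finite[OF proper gC] by auto
      have le: "f \<bullet> (y - x) \<le> h \<bullet> (y - x)" if f: "f \<in> subdifferential R x" for f
        using subgradient_ineq[OF f r, of y "r + h \<bullet> (y - x)"] Ry r by simp
      have perp: "w \<bullet> (y - x) = 0" if w: "w \<in> par (subdifferential R x)" for w
      proof -
        obtain c where c: "c > 0" "\<And>t. \<bar>t\<bar> \<le> c \<Longrightarrow> h + t *\<^sub>R w \<in> subdifferential R x"
          using rel_interior_perturb[OF hri w] by blast
        have "c * (w \<bullet> (y - x)) \<le> 0" "- c * (w \<bullet> (y - x)) \<le> 0"
          using le[OF c(2)[of c]] le[OF c(2)[of "- c"]] c(1) by (simp_all add: inner_add_left inner_diff_left)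
        then show ?thesis using c(1) by (simp add: mult_le_0_iff zero_le_mult_iff)
      qed
      then have "y - x \<in> model_subspace R x"
        by (auto simp: model_subspace_def orthogonal_comp_def orthogonal_def)
      moreover have "h \<bullet> (y - x) = g \<bullet> (y - x)"
        using perp[OF diff_mem_par[OF hx gC]] by (simp add: inner_diff_left)
      ultimately show "y - x \<in> model_subspace R x \<and> R y = R x + ereal (g \<bullet> (y - x))" using Ry by simp
    qed
  qed
qed

text \<open>
  \<open>M\<close> fills the affine tangent space by invariance of domain for the inverse chart, which maps an
  open part of the slice \<open>S\<close> into an affine space of no larger dimension.
\<close>
lemma submanifold_in_tangent_affine_coincide:
  fixes M :: "'a::euclidean_space set"
  assumes M: "C2_submanifold_around M x" and sub: "subspace (tangent_space M x)"
    and ev: "\<forall>\<^sub>F y in nhds x. y \<in> M \<longrightarrow> y - x \<in> tangent_space M x"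
  shows "coincide_around x M ((+) x ` tangent_space M x)"
proof -
  obtain U W \<phi> \<psi> L and S :: "'a set" where *: "open U" "x \<in> U" "open W" "subspace S"
    "homeomorphism U W \<phi> \<psi>" "\<phi> ` (M \<inter> U) = S \<inter> W" "linear L" "inj L" "tangent_space M x \<subseteq> L ` S"
    by (rule C2_submanifold_chart[OF M]) blast
  have xM: "x \<in> M" using M by (simp add: C2_submanifold_around_def)
  have \<psi>\<phi>: "\<psi> (\<phi> y) = y" if "y \<in> U" for y using *(5) that by (simp add: homeomorphism_def)
  have \<phi>x: "\<phi> x \<in> S" "\<phi> x \<in> W" using *(2,6) xM by blast+
  have cont: "continuous_on W \<psi>" using *(5) by (simp add: homeomorphism_def)
  have inj: "inj_on \<psi> W" using *(5) by (metis homeomorphism_def inj_on_inverseI)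
  obtain N where N: "open N" "x \<in> N" "\<And>y. y \<in> N \<Longrightarrow> y \<in> M \<Longrightarrow> y - x \<in> tangent_space M x"
    using ev unfolding eventually_nhds by blast
  define W' where "W' = W \<inter> \<psi> -` N"
  have W': "open W'" unfolding W'_def using continuous_open_preimage[OF cont *(3) N(1)] .
  have \<psi>M: "\<psi> s \<in> M" if "s \<in> S" "s \<in> W" for s
  proof -
    obtain m where "m \<in> M" "m \<in> U" "s = \<phi> m" using \<open>s \<in> S\<close> \<open>s \<in> W\<close> *(6) by blast
    then show ?thesis using \<psi>\<phi> by simp
  qed
  have aff: "affine ((+) x ` tangent_space M x)"
    using sub affine_translation subspace_affine by blast
  have "dim (tangent_space M x) \<le> dim (L ` S)" using *(9) by (rule dim_subset)
  also have "\<dots> \<le> dim S" by (rule dim_image_le[OF *(7)])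
  finally have dim: "aff_dim ((+) x ` tangent_space M x) \<le> aff_dim S"
    using aff_dim_subspace[OF sub] aff_dim_subspace[OF *(4)] by (simp add: aff_dim_translation_eq)
  have "openin (top_of_set ((+) x ` tangent_space M x)) (\<psi> ` (S \<inter> W'))"
  proof (rule invariance_of_domain_affine_sets[OF _ _ aff dim])
    show "openin (top_of_set S) (S \<inter> W')" using W' by (rule openin_open_Int)
    show "affine S" using *(4) subspace_affine by blast
    show "continuous_on (S \<inter> W') \<psi>" by (rule continuous_on_subset[OF cont]) (auto simp: W'_def)
    show "inj_on \<psi> (S \<inter> W')" by (rule inj_on_subset[OF inj]) (auto simp: W'_def)
    show "\<psi> \<in> S \<inter> W' \<rightarrow> (+) x ` tangent_space M x"
    proof
      fix s assume s: "s \<in> S \<inter> W'"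
      then have "\<psi> s - x \<in> tangent_space M x" using N(3) \<psi>M by (auto simp: W'_def)
      then show "\<psi> s \<in> (+) x ` tangent_space M x" by (intro image_eqI[of _ _ "\<psi> s - x"]) auto
    qed
  qed
  then obtain N1 where N1: "open N1" "\<psi> ` (S \<inter> W') = (+) x ` tangent_space M x \<inter> N1"
    by (auto simp: openin_open)
  have "x \<in> \<psi> ` (S \<inter> W')"
    using \<phi>x \<psi>\<phi>[OF *(2)] N(2) by (auto simp: W'_def intro!: image_eqI[of _ _ "\<phi> x"])
  then have "x \<in> N1" using N1(2) by blast
  moreover have "M \<inter> (N \<inter> N1) = (+) x ` tangent_space M x \<inter> (N \<inter> N1)"
  proof (intro equalityI subsetI)
    fix y assume y: "y \<in> M \<inter> (N \<inter> N1)"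
    then have "y - x \<in> tangent_space M x" using N(3) by blast
    then show "y \<in> (+) x ` tangent_space M x \<inter> (N \<inter> N1)"
      using y by (auto intro!: image_eqI[of _ _ "y - x"])
  next
    fix y assume y: "y \<in> (+) x ` tangent_space M x \<inter> (N \<inter> N1)"
    then have "y \<in> \<psi> ` (S \<inter> W')" using N1(2) by blast
    then show "y \<in> M \<inter> (N \<inter> N1)" using y \<psi>M by (auto simp: W'_def)
  qed
  ultimately show ?thesis
    unfolding coincide_around_def using N N1(1) by (intro exI[of _ "N \<inter> N1"]) auto
qed

section \<open>The Forward--Douglas--Rachford iteration\<close>

lemma flat_manifold_derivatives:
  fixes M :: "'a::euclidean_space set"
  assumes T: "subspace T" and N: "open N" "M \<inter> N = (+) x ` T \<inter> N" and y: "y \<in> M" "y \<in> N"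
    and C2: "C2_submanifold_around M y" "C2_along_around J M y"
    and J: "\<And>z. z \<in> M \<Longrightarrow> z \<in> N \<Longrightarrow> J z = ereal (r + g \<bullet> (z - x))"
    and v: "v \<in> T" "\<And>h. h \<in> T \<Longrightarrow> v \<bullet> h = g \<bullet> h"
  shows "has_riemannian_gradient J M y v" and "has_riemannian_hessian J M y (\<lambda>h. 0)"
proof -
  have "y \<in> (+) x ` T" using y N(2) by blast
  then have yx: "y - x \<in> T" by auto
  have line: "\<exists>A. open A \<and> (0::real) \<in> A \<and> (\<forall>t\<in>A. y + t *\<^sub>R h \<in> M \<inter> N)" if h: "h \<in> T" for h
  proof (intro exI conjI ballI)
    show "open ((\<lambda>t. y + t *\<^sub>R h) -` N)"
      using N(1) by (intro open_vimage) (auto intro!: continuous_intros)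
    show "0 \<in> (\<lambda>t. y + t *\<^sub>R h) -` N" using y by simp
    fix t assume "t \<in> (\<lambda>t. y + t *\<^sub>R h) -` N"
    moreover have "y + t *\<^sub>R h \<in> (+) x ` T"
      using subspace_add[OF T yx subspace_mul[OF T h, of t]]
      by (intro image_eqI[of _ _ "(y - x) + t *\<^sub>R h"]) auto
    ultimately show "y + t *\<^sub>R h \<in> M \<inter> N" using N(2) by blast
  qed
  have tan: "tangent_space M y = T"
  proof (intro equalityI subsetI)
    fix h assume "h \<in> tangent_space M y"
    then obtain c e where c: "e > 0" "c ` {-e<..<e} \<subseteq> M" "c 0 = y" "(c has_vector_derivative h) (at 0)"
      by (auto simp: tangent_space_def)
    have "isCont c 0" using c(4) has_vector_derivative_continuous by blast
    then have "(c \<longlongrightarrow> c 0) (nhds 0)" by (simp only: isCont_def tendsto_at_iff_tendsto_nhds)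
    then have "\<forall>\<^sub>F t in nhds 0. c t \<in> N" by (rule topological_tendstoD[OF _ N(1)]) (simp add: c(3) y)
    moreover have "\<forall>\<^sub>F t in nhds 0. t \<in> {-e<..<e}" using c(1) by (intro eventually_nhds_in_open) auto
    ultimately have "\<forall>\<^sub>F t in nhds 0. c t - c 0 \<in> T"
    proof eventually_elim
      case (elim t)
      then have "c t \<in> (+) x ` T" using c(2) N(2) by blast
      then have "c t - x \<in> T" by auto
      then have "(c t - x) - (y - x) \<in> T" using yx by (rule subspace_diff[OF T])
      then show ?case using c(3) by simp
    qed
    then show "h \<in> T" by (rule velocity_in_subspace[OF c(4) T])
  next
    fix h assume "h \<in> T"
    then obtain A where A: "open A" "(0::real) \<in> A" "\<forall>t\<in>A. y + t *\<^sub>R h \<in> M \<inter> N" using line by blast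
    obtain e where e: "e > 0" "ball 0 e \<subseteq> A" using A open_contains_ball by blast
    have der: "((\<lambda>t. y + t *\<^sub>R h) has_vector_derivative h) (at t)" for t
      by (auto intro!: derivative_eq_intros)
    have "(\<lambda>t. y + t *\<^sub>R h) C1_differentiable_on {-e<..<e}"
      unfolding C1_differentiable_on_def by (rule exI[of _ "\<lambda>_. h"]) (use der in auto)
    moreover have "(\<lambda>t. y + t *\<^sub>R h) ` {-e<..<e} \<subseteq> M"
      using A(3) e(2) by (auto simp: subset_iff dist_real_def)
    ultimately show "h \<in> tangent_space M y"
      unfolding tangent_space_def using e(1) der[of 0]
      by (intro CollectI exI[of _ "\<lambda>t. y + t *\<^sub>R h"] exI[of _ e]) auto
  qed
  define f where "f h = (\<lambda>t. real_of_ereal (J (closest_point M (y + t *\<^sub>R h))))" for h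
  have deriv: "\<forall>\<^sub>F s in nhds 0. (f h has_real_derivative g \<bullet> h) (at s)" if h: "h \<in> T" for h
  proof -
    obtain A where A: "open A" "(0::real) \<in> A" "\<forall>t\<in>A. y + t *\<^sub>R h \<in> M \<inter> N" using line[OF h] by blast
    have "(f h has_real_derivative g \<bullet> h) (at s)" if s: "s \<in> A" for s
    proof (rule has_field_derivative_transform_within_open[OF _ A(1) s])
      show "((\<lambda>t. r + g \<bullet> (y - x) + t * (g \<bullet> h)) has_real_derivative g \<bullet> h) (at s)"
        by (auto intro!: derivative_eq_intros)
      fix t assume "t \<in> A"
      then have "closest_point M (y + t *\<^sub>R h) = y + t *\<^sub>R h"
        "J (y + t *\<^sub>R h) = ereal (r + g \<bullet> (y + t *\<^sub>R h - x))"
        using A(3) by (auto simp: closest_point_self J)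
      then show "r + g \<bullet> (y - x) + t * (g \<bullet> h) = f h t"
        by (simp add: f_def inner_add_right inner_diff_right)
    qed
    then show ?thesis using A(1,2) by (auto simp: eventually_nhds)
  qed
  have "(f h has_real_derivative v \<bullet> h) (at 0)" if "h \<in> T" for h
    using eventually_nhds_x_imp_x[OF deriv[OF that]] v(2)[OF that] by simp
  then show "has_riemannian_gradient J M y v"
    unfolding has_riemannian_gradient_def tan using C2 v(1) by (simp add: f_def)
  have "has_second_derivative_at (f h) 0 0" if "h \<in> T" for h
    unfolding has_second_derivative_at_def
    by (rule exI[of _ "\<lambda>_. g \<bullet> h"]) (use deriv[OF that] in auto)
  then show "has_riemannian_hessian J M y (\<lambda>h. 0)"
    unfolding has_riemannian_hessian_def tan using C2 subspace_0[OF T] by (auto simp: f_def)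
qed

theorem theorem4p1:
  fixes R :: "'a::euclidean_space \<Rightarrow> ereal"
    and F G :: "'a \<Rightarrow> real"
    and gradF gradG :: "'a \<Rightarrow> 'a"
    and V M :: "'a set"
    and \<Phi> :: "'a \<Rightarrow> ereal"
    and \<beta> \<beta>V \<gamma>lo \<gamma>hi \<gamma> :: real
    and gam lam :: "nat \<Rightarrow> real"
    and u z x :: "nat \<Rightarrow> 'a"
    and xs zs :: 'a
  assumes R: "proper_fun R" "convex_fun R" "lsc_fun R"
    and F_convex: "convex_on UNIV F"
    and F_grad: "\<And>y. GDERIV F y :> gradF y" "continuous_on UNIV gradF"
    and beta_pos: "\<beta> > 0"
    and F_lipschitz: "(1 / \<beta>)-lipschitz_on UNIV gradF"
    and V: "subspace V"
    and G_def: "G = F \<circ> closest_point V"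
    and G_grad: "\<And>y. GDERIV G y :> gradG y"
    and betaV: "\<beta>V \<ge> \<beta>"
    and G_lipschitz: "(1 / \<beta>V)-lipschitz_on UNIV gradG"
    and Phi_def: "\<Phi> = (\<lambda>y. ereal (G y) + R y + indicator_fun V y)"
    and Argmin_nonempty: "Argmin \<Phi> \<noteq> {}"
    and gam_bounds: "0 < \<gamma>lo" "\<And>k. \<gamma>lo \<le> gam k" "\<And>k. gam k \<le> \<gamma>hi" "\<gamma>hi < 2 * \<beta>V"
    and gam_lim: "gam \<longlonglongrightarrow> \<gamma>" "\<gamma> \<in> {\<gamma>lo..\<gamma>hi}"
    and lam_bounds: "\<And>k. lam k \<in> {0<..<(4 * \<beta>V - gam k) / (2 * \<beta>V)}"
    and lam_diverges: "(\<Sum>k. ereal (lam k * ((4 * \<beta>V - gam k) / (2 * \<beta>V) - lam k))) = \<infinity>"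
    and lam_gam_summable: "summable (\<lambda>k. lam k * \<bar>gam k - \<gamma>\<bar>)"
    and x_0: "x 0 = closest_point V (z 0)"
    and u_Suc: "\<And>k. u (Suc k) = prox (gam k) R (2 *\<^sub>R x k - z k - gam k *\<^sub>R gradG (x k))"
    and z_Suc: "\<And>k. z (Suc k) = z k + lam k *\<^sub>R (u (Suc k) - x k)"
    and x_Suc: "\<And>k. x (Suc k) = closest_point V (z (Suc k))"
    and convergence: "u \<longlonglongrightarrow> xs" "x \<longlonglongrightarrow> xs" "z \<longlonglongrightarrow> zs"
    and zs_fix: "zs \<in> fix_set (fdr_operator \<gamma> R V gradG)"
    and xs: "xs = closest_point V zs" "xs \<in> Argmin \<Phi>"
    and partly_smooth: "partly_smooth_at R xs M"
    and nondegenerate: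
      "(1 / \<gamma>) *\<^sub>R (xs - zs) - gradG xs \<in> rel_interior (subdifferential R xs)"
  shows "\<exists>K.
     (\<forall>k\<ge>K. u k \<in> M) \<and>
     (coincide_around xs M ((+) xs ` model_subspace R xs) \<longrightarrow>
        (\<forall>k\<ge>K. model_subspace R (u k) = model_subspace R xs)) \<and>
     (locally_polyhedral_around R xs \<longrightarrow>
        coincide_around xs M ((+) xs ` model_subspace R xs) \<and>
        (\<exists>g. has_riemannian_gradient R M xs g \<and>
           (\<forall>k\<ge>K.
              u k \<in> M \<and> u k \<in> (+) xs ` model_subspace R xs \<and>
              model_subspace R (u k) = model_subspace R xs \<and>
              has_riemannian_gradient R M (u k) g \<and>
              has_riemannian_hessian R M (u k) (\<lambda>h. 0))))"
proof -
  define T where "T = model_subspace R xs"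
  have T: "subspace T" unfolding T_def by (rule subspace_model_subspace)
  define g where "g = (1 / \<gamma>) *\<^sub>R (xs - zs) - gradG xs"
  have ri: "g \<in> rel_interior (subdifferential R xs)" using nondegenerate by (simp add: g_def)
  have gC: "g \<in> subdifferential R xs" using ri rel_interior_subset by blast
  have ne: "subdifferential R xs \<noteq> {}" using gC by blast
  have \<gamma>: "\<gamma> > 0" using gam_bounds(1) gam_lim(2) by auto
  have gam: "gam k > 0" for k using gam_bounds(1) gam_bounds(2)[of k] by linarith
  define w where "w k = 2 *\<^sub>R x k - z k - gam k *\<^sub>R gradG (x k)" for k
  define h where "h k = (1 / gam k) *\<^sub>R (w k - u (Suc k))" for k
  have hsub: "h k \<in> subdifferential R (u (Suc k))" for k
    unfolding h_def u_Suc w_def[symmetric] by (rule prox_subgradient[OF R gam ne])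
  have "isCont gradG xs"
    using lipschitz_on_continuous_on[OF G_lipschitz] by (simp add: continuous_on_eq_continuous_at)
  then have gradx: "(\<lambda>k. gradG (x k)) \<longlonglongrightarrow> gradG xs"
    using convergence(2) by (rule isCont_tendsto_compose)
  have usuc: "(\<lambda>k. u (Suc k)) \<longlonglongrightarrow> xs" using convergence(1) by (rule LIMSEQ_Suc)
  have "h \<longlonglongrightarrow> (1 / \<gamma>) *\<^sub>R (2 *\<^sub>R xs - zs - \<gamma> *\<^sub>R gradG xs - xs)"
    unfolding h_def w_def
    by (intro tendsto_intros gradx usuc convergence(2,3) gam_lim(1)) (use \<gamma> in auto)
  also have "(1 / \<gamma>) *\<^sub>R (2 *\<^sub>R xs - zs - \<gamma> *\<^sub>R gradG xs - xs) = g"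
    using \<gamma> by (simp add: g_def scaleR_2 scaleR_diff_right scaleR_add_right algebra_simps)
  finally have hlim: "h \<longlonglongrightarrow> g" .
  have "\<forall>\<^sub>F k in sequentially. u (Suc k) \<in> M"
    by (rule partly_smooth_identification[OF R(1) partly_smooth usuc hsub hlim ri])
  then have inM: "\<forall>\<^sub>F k in sequentially. u k \<in> M" using eventually_sequentially_Suc[of "\<lambda>k. u k \<in> M"] by simp
  have ev: "\<forall>\<^sub>F k in sequentially. P (u k)" if "\<forall>\<^sub>F y in nhds xs. P y" for P
    using that convergence(1) by (rule eventually_compose_filterlim)
  have modelT: "\<forall>\<^sub>F k in sequentially. model_subspace R (u k) = T" if "coincide_around xs M ((+) xs ` T)"
    using ev[OF model_subspace_locally_constant[OF R(1) partly_smooth that[unfolded T_def] ri]] inM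
    by eventually_elim (simp add: T_def)
  have ps: "C2_submanifold_around M xs" "C2_along_around R M xs" "tangent_space M xs = T" "xs \<in> M"
    using partly_smooth by (auto simp: partly_smooth_at_def T_def)
  define v where "v = closest_point T g"
  have "v \<in> T"
    unfolding v_def using T subspace_0[OF T] by (intro closest_point_in_set) (auto simp: closed_subspace)
  moreover have "v \<bullet> h = g \<bullet> h" if "h \<in> T" for h
    using closest_point_subspace_orthogonal[OF T, of g] that
    by (auto simp: v_def orthogonal_comp_def orthogonal_def inner_diff_right inner_commute)
  ultimately have v: "v \<in> T" "\<And>h. h \<in> T \<Longrightarrow> v \<bullet> h = g \<bullet> h" .
  have poly: "coincide_around xs M ((+) xs ` T) \<and> has_riemannian_gradient R M xs v \<and>
      (\<forall>\<^sub>F k in sequentially. u k \<in> (+) xs ` T \<and>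
         has_riemannian_gradient R M (u k) v \<and> has_riemannian_hessian R M (u k) (\<lambda>h. 0))"
    if "locally_polyhedral_around R xs"
  proof -
    note active = polyhedral_active_manifold[OF R(1) partly_smooth that ri, folded T_def]
    have "\<forall>\<^sub>F y in nhds xs. y \<in> M \<longrightarrow> y - xs \<in> tangent_space M xs"
      using active by eventually_elim (simp add: ps(3))
    then have coincide: "coincide_around xs M ((+) xs ` T)"
      using submanifold_in_tangent_affine_coincide[OF ps(1)] T ps(3) by simp
    obtain r where r: "R xs = ereal r" using subgradient_finite[OF R(1) gC] by auto
    obtain N1 where N1: "open N1" "xs \<in> N1" "M \<inter> N1 = (+) xs ` T \<inter> N1"
      using coincide unfolding coincide_around_def by blast
    obtain N2 where N2: "open N2" "xs \<in> N2" "\<And>y. y \<in> N2 \<Longrightarrow> y \<in> M \<Longrightarrow> R y = R xs + ereal (g \<bullet> (y - xs))"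
      using active unfolding eventually_nhds by blast
    have N: "open (N1 \<inter> N2)" "M \<inter> (N1 \<inter> N2) = (+) xs ` T \<inter> (N1 \<inter> N2)" "xs \<in> N1 \<inter> N2"
      "\<And>y. y \<in> M \<Longrightarrow> y \<in> N1 \<inter> N2 \<Longrightarrow> R y = ereal (r + g \<bullet> (y - xs))"
      using N1 N2 r by auto
    note flat = flat_manifold_derivatives[OF T N(1,2) _ _ _ _ N(4) v]
    have "\<forall>\<^sub>F y in nhds xs. y \<in> N1 \<inter> N2" using N by (intro eventually_nhds_in_open) auto
    note near = ev[OF this] ev[OF C2_submanifold_around_near[OF ps(1)]] ev[OF C2_along_around_near[OF ps(2)]]
    have "\<forall>\<^sub>F k in sequentially. u k \<in> (+) xs ` T \<and>
         has_riemannian_gradient R M (u k) v \<and> has_riemannian_hessian R M (u k) (\<lambda>h. 0)"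
      using inM near
    proof eventually_elim
      case (elim k)
      then show ?case using flat[of "u k"] N(2) by blast
    qed
    then show ?thesis using coincide flat(1)[OF ps(4) N(3) ps(1,2)] by blast
  qed
  have "\<forall>\<^sub>F k in sequentially. coincide_around xs M ((+) xs ` T) \<longrightarrow> model_subspace R (u k) = T"
    using modelT by (cases "coincide_around xs M ((+) xs ` T)") simp_all
  moreover have "\<forall>\<^sub>F k in sequentially. locally_polyhedral_around R xs \<longrightarrow> u k \<in> (+) xs ` T \<and>
      has_riemannian_gradient R M (u k) v \<and> has_riemannian_hessian R M (u k) (\<lambda>h. 0)"
    using poly by (cases "locally_polyhedral_around R xs") simp_all
  ultimately have "\<forall>\<^sub>F k in sequentially. u k \<in> M \<and>
      (coincide_around xs M ((+) xs ` T) \<longrightarrow> model_subspace R (u k) = T) \<and>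
      (locally_polyhedral_around R xs \<longrightarrow> u k \<in> (+) xs ` T \<and>
         has_riemannian_gradient R M (u k) v \<and> has_riemannian_hessian R M (u k) (\<lambda>h. 0))"
    using inM by (intro eventually_conj)
  then obtain K where K: "\<And>k. k \<ge> K \<Longrightarrow> u k \<in> M \<and>
      (coincide_around xs M ((+) xs ` T) \<longrightarrow> model_subspace R (u k) = T) \<and>
      (locally_polyhedral_around R xs \<longrightarrow> u k \<in> (+) xs ` T \<and>
         has_riemannian_gradient R M (u k) v \<and> has_riemannian_hessian R M (u k) (\<lambda>h. 0))"
    unfolding eventually_sequentially by blast
  show ?thesis
    unfolding T_def[symmetric]
  proof (intro exI[of _ K] conjI allI impI)
    assume "locally_polyhedral_around R xs"
    with poly K show "\<exists>g. has_riemannian_gradient R M xs g \<and>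
        (\<forall>k\<ge>K. u k \<in> M \<and> u k \<in> (+) xs ` T \<and> model_subspace R (u k) = T \<and>
           has_riemannian_gradient R M (u k) g \<and> has_riemannian_hessian R M (u k) (\<lambda>h. 0))"
      by (intro exI[of _ v]) blast
  qed (use K poly in blast)+
qed

end
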